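(* Let $C\subseteq\mathbb{F}_2^n$ be a binary linear $[n,k,d]$ code with $\mathbf{1}_n\in C$, whose dual $C^\perp$ has minimum distance $d^\perp$, and let $t$ be a positive integer such that $$d^\perp-t=\#\{u \mid C_u\neq\emptyset,\ 0<u\le n-t\}.$$ (1) If $d^\perp-t=1$, then $(d^\perp,t)=(2,1)$ or $(4,3)$. Moreover, $\delta(C)=s(C)=\delta(C^\perp)=s(C^\perp)$ and this common value is $1$ or $3$. (2) If $d^\perp-t=2$, then $(d^\perp,t)=(4,2)$. (3) If $d^\perp-t=3$, then $(d^\perp,t)\in\{(4,1),(6,3),(8,5)\}$.
   Context: $\mathbf{1}_n$ is the all-ones vector. $C^\perp=\{y\in\mathbb{F}_2^n : \sum_i x_iy_i=0 \text{ for all } x\in C\}$, and $d^\perp$ is the minimum weight of a nonzero vector of $C^\perp$ (assumed $C^\perp\neq 0$). For $u$, $C_u=\{c\in C : \mathrm{wt}(c)=u\}$, where $\mathrm{wt}$ is the Hamming weight. A $t$-$(v,k,\lambda)$ design is a pair $(X,\mathcal{B})$ with $|X|=v$ and $\mathcal{B}$ a collection of $k$-subsets of $X$ (blocks) such that every $t$-subset of $X$ is contained in exactly $\lambda$ blocks. The support of $x\in\mathbb{F}_2^n$ is $\mathrm{supp}(x)=\{i : x_i\neq 0\}$. The support design $D_w$ of $C$ for weight $w$ has point set $\{1,\dots,n\}$ and blocks the supports of the codewords of $C$ of weight $w$; similarly for $C^\perp$. $\delta(C)=\max\{t\in\mathbb{N} \mid D_w \text{ is a } t\text{-design for every } w\}$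 and $s(C)=\max\{t\in\mathbb{N}\mid D_w \text{ is a } t\text{-design for some } w\}$, where $w$ ranges over the weights with $0<w<n$ occurring in $C$; $\delta(C^\perp), s(C^\perp)$ are defined in the same way for $C^\perp$. *)

theory Defs
  imports Main "HOL-Library.Z2"
begin

text \<open>Vectors of F_2^n are modelled as functions nat => bit vanishing outside
  the coordinates 0..n-1.\<close>

definition vecs :: "nat \<Rightarrow> (nat \<Rightarrow> bit) set" where
  "vecs n = {x. \<forall>i. n \<le> i \<longrightarrow> x i = 0}"

definition vadd :: "(nat \<Rightarrow> bit) \<Rightarrow> (nat \<Rightarrow> bit) \<Rightarrow> (nat \<Rightarrow> bit)" where
  "vadd x y = (\<lambda>i. x i + y i)"

definition zero_vec :: "nat \<Rightarrow> bit" where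
  "zero_vec = (\<lambda>i. 0)"

definition ones_vec :: "nat \<Rightarrow> nat \<Rightarrow> bit" where
  "ones_vec n = (\<lambda>i. if i < n then 1 else 0)"

text \<open>A binary linear code of length n: an F_2-subspace of F_2^n
  (over F_2, closure under addition and containing 0 suffices).\<close>

definition binary_linear_code :: "nat \<Rightarrow> (nat \<Rightarrow> bit) set \<Rightarrow> bool" where
  "binary_linear_code n C \<longleftrightarrow>
     C \<subseteq> vecs n \<and> zero_vec \<in> C \<and> (\<forall>x\<in>C. \<forall>y\<in>C. vadd x y \<in> C)"

definition dual_code :: "nat \<Rightarrow> (nat \<Rightarrow> bit) set \<Rightarrow> (nat \<Rightarrow> bit) set" where
  "dual_code n C = {y \<in> vecs n. \<forall>x\<in>C. (\<Sum>i<n. x i * y i) = 0}"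

definition supp :: "nat \<Rightarrow> (nat \<Rightarrow> bit) \<Rightarrow> nat set" where
  "supp n x = {i. i < n \<and> x i \<noteq> 0}"

definition wt :: "nat \<Rightarrow> (nat \<Rightarrow> bit) \<Rightarrow> nat" where
  "wt n x = card (supp n x)"

definition min_weight :: "nat \<Rightarrow> (nat \<Rightarrow> bit) set \<Rightarrow> nat" where
  "min_weight n C = Min {wt n c | c. c \<in> C \<and> c \<noteq> zero_vec}"

definition weight_class :: "nat \<Rightarrow> (nat \<Rightarrow> bit) set \<Rightarrow> nat \<Rightarrow> (nat \<Rightarrow> bit) set" where
  "weight_class n C u = {c \<in> C. wt n c = u}"

definition inner_weights :: "nat \<Rightarrow> (nat \<Rightarrow> bit) set \<Rightarrow> nat set" where
  "inner_weights n C = {w. 0 < w \<and> w < n \<and> weight_class n C w \<noteq> {}}"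

definition is_t_design :: "nat \<Rightarrow> nat \<Rightarrow> nat set set \<Rightarrow> nat \<Rightarrow> bool" where
  "is_t_design v k B t \<longleftrightarrow>
     (\<forall>b\<in>B. b \<subseteq> {..<v} \<and> card b = k) \<and> t \<le> k \<and>
     (\<exists>lam. \<forall>T. T \<subseteq> {..<v} \<and> card T = t \<longrightarrow> card {b\<in>B. T \<subseteq> b} = lam)"

definition support_design :: "nat \<Rightarrow> (nat \<Rightarrow> bit) set \<Rightarrow> nat \<Rightarrow> nat set set" where
  "support_design n C w = supp n ` weight_class n C w"

definition delta_code :: "nat \<Rightarrow> (nat \<Rightarrow> bit) set \<Rightarrow> nat" where
  "delta_code n C = (GREATEST t. \<forall>w\<in>inner_weights n C.
      is_t_design n w (support_design n C w) t)"

definition s_code :: "nat \<Rightarrow> (nat \<Rightarrow> bit) set \<Rightarrow> nat" where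
  "s_code n C = (GREATEST t. \<exists>w\<in>inner_weights n C.
      is_t_design n w (support_design n C w) t)"

end

theory Submission
  imports Defs "HOL-Computational_Algebra.Polynomial" "HOL-Computational_Algebra.Primes"
begin

text \<open>Let \<open>W\<close> be the set of weights of \<open>C\<close> strictly between \<open>0\<close> and \<open>n\<close>, and \<open>S\<close> the set of
  those that are at most \<open>n - t\<close>. If some weight exceeded \<open>n - t\<close>, the complementary words would
  give a minimum weight \<open>m < t\<close>; by the Assmus--Mattson argument the words of weight \<open>m\<close> form a
  design, so every \<open>m\<close>-set would be a support, which leaves only the dual \<open>{0, 1}\<close> and a
  contradiction. Hence \<open>W = S\<close>. As \<open>C\<close> is an orthogonal array of strength \<open>d\<^sup>\<bottom> - 1\<close>, it averages
  polynomials of degree less than \<open>d\<^sup>\<bottom>\<close> in the weight \<open>x\<close> exactly as the whole space does;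
  applied to the nonnegative polynomial \<open>x (n - x) \<Prod> (x - w)\<^sup>2\<close>, with \<open>w\<close> ranging over \<open>W\<close>, this
  yields \<open>d\<^sup>\<bottom> \<le> 2 |W| + 2\<close>. Since \<open>d\<^sup>\<bottom>\<close> is even, only the case \<open>|W| = 2\<close>, \<open>d\<^sup>\<bottom> = 6\<close> has to be
  excluded separately. For \<open>W = {n / 2}\<close>, Poisson summation shows that the weight enumerators of
  the dual words through two sets \<open>T\<close>, \<open>T'\<close> of the same size \<open>\<tau> \<le> d\<^sup>\<bottom>\<close> differ only if exactly
  one of them is the support of a dual word, and then by \<open>(1 - X\<^sup>2)\<close> to the power
  \<open>n / 2 - \<tau>\<close>.\<close>

section \<open>Parity of symmetric differences, and sign characters\<close>

lemma even_card_sym_diff: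
  assumes "finite A" "finite B"
  shows "even (card (sym_diff A B)) \<longleftrightarrow> (even (card A) \<longleftrightarrow> even (card B))"
proof -
  have "card (sym_diff A B) = card (A - B) + card (B - A)"
    using assms by (intro card_Un_disjoint) auto
  moreover have "card A = card (A - B) + card (A \<inter> B)"
    using assms card_Un_disjoint[of "A - B" "A \<inter> B"] by (simp add: Un_Diff_Int Int_Diff_disjoint inf_sup_aci)
  moreover have "card B = card (B - A) + card (A \<inter> B)"
    using assms card_Un_disjoint[of "B - A" "A \<inter> B"]
    by (metis Diff_disjoint Int_Diff_Un Int_commute Un_commute card_Int_Diff add.commute)
  ultimately show ?thesis by auto
qed

text \<open>The sign character of coordinate \<open>i\<close> at the word with support
  \<open>c\<close>. The ring is left open because the sums below run over integers as well as
  integer polynomials.\<close>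

definition chi :: "'a \<Rightarrow> 'a set \<Rightarrow> 'b::comm_ring_1"
  where "chi i c = (if i \<in> c then - 1 else 1)"

lemma prod_chi:
  "finite T \<Longrightarrow> (\<Prod>i\<in>T. chi i c) = (-1) ^ card (c \<inter> T)"
  by (induction T rule: finite_induct) (auto simp: chi_def Int_insert_right)

subsection \<open>Characters and orthogonal arrays\<close>

text \<open>Binary codes are represented by the supports of their words, so that addition becomes
  symmetric difference and the inner product becomes the parity of an intersection.\<close>

locale set_code =
  fixes V :: "'a set" and F :: "'a set set"
  assumes finV: "finite V" and subV: "c \<in> F \<Longrightarrow> c \<subseteq> V" and empty_mem: "{} \<in> F"
    and sym_diff_mem: "x \<in> F \<Longrightarrow> y \<in> F \<Longrightarrow> sym_diff x y \<in> F"
begin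

definition dual :: "'a set set"
  where "dual = {y. y \<subseteq> V \<and> (\<forall>x\<in>F. even (card (x \<inter> y)))}"

text \<open>Delsarte's dual form of an orthogonal array of strength \<open>k\<close>; the array
  property itself is \<open>card_pattern_strength\<close>.\<close>

definition strength :: "nat \<Rightarrow> bool"
  where "strength k \<longleftrightarrow> (\<forall>y\<in>dual. y \<noteq> {} \<longrightarrow> k < card y)"

lemma finF: "finite F"
  using finV subV by (meson PowI finite_Pow_iff finite_subset subsetI)

lemma finite_word: "c \<in> F \<Longrightarrow> finite c"
  using finV subV finite_subset by blast

lemma card_F_pos: "0 < card F"
  using finF empty_mem card_gt_0_iff by blast

lemma empty_mem_dual: "{} \<in> dual"
  by (simp add: dual_def)

lemma dual_subset: "y \<in> dual \<Longrightarrow> y \<subseteq> V"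
  by (simp add: dual_def)

lemma finite_dual: "finite dual"
  using finV dual_subset by (meson PowI finite_Pow_iff finite_subset subsetI)

lemma dual_even: "y \<in> dual \<Longrightarrow> x \<in> F \<Longrightarrow> even (card (x \<inter> y))"
  by (simp add: dual_def)

lemma dual_sym_diff:
  assumes "x \<in> dual" "y \<in> dual"
  shows "sym_diff x y \<in> dual"
proof -
  have "even (card (z \<inter> sym_diff x y))" if "z \<in> F" for z
  proof -
    have "z \<inter> sym_diff x y = sym_diff (z \<inter> x) (z \<inter> y)" by auto
    then show ?thesis
      using even_card_sym_diff[of "z \<inter> x" "z \<inter> y"] assms that finite_word[OF that] dual_even by simp
  qed
  then show ?thesis using assms by (auto simp: dual_def)
qed

lemma bij_sym_diff:
  assumes "x \<in> F"
  shows "bij_betw (\<lambda>c. sym_diff c x) F F"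
  by (rule bij_betw_byWitness[where f' = "\<lambda>c. sym_diff c x"]) (use assms sym_diff_mem in auto)

text \<open>For \<open>T\<close> outside the dual, translation by a word meeting \<open>T\<close> in
  an odd number of points permutes \<open>F\<close> and reverses the sign of every term.\<close>

lemma sum_character:
  assumes "T \<subseteq> V"
  shows "(\<Sum>c\<in>F. \<Prod>i\<in>T. chi i c :: 'b::{idom,ring_char_0})
    = (if T \<in> dual then of_nat (card F) else 0)"
proof (cases "T \<in> dual")
  case True
  have "finite T" using assms finV finite_subset by blast
  then have "(\<Prod>i\<in>T. chi i c :: 'b) = 1" if "c \<in> F" for c
    using that True by (simp add: prod_chi dual_even)
  then show ?thesis using True by simp
next
  case False
  have fT: "finite T" using assms finV finite_subset by blast
  obtain x where x: "x \<in> F" "odd (card (x \<inter> T))"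
    using False assms by (auto simp: dual_def)
  let ?S = "\<Sum>c\<in>F. \<Prod>i\<in>T. chi i c :: 'b"
  have mult: "chi i (sym_diff c x) = (chi i c * chi i x :: 'b)" for i c
    by (auto simp: chi_def)
  have "?S = (\<Sum>c\<in>F. \<Prod>i\<in>T. chi i (sym_diff c x))"
    by (rule sum.reindex_bij_betw[OF bij_sym_diff[OF x(1)], symmetric])
  also have "\<dots> = (\<Sum>c\<in>F. - (\<Prod>i\<in>T. chi i c))"
    by (simp only: mult prod.distrib prod_chi[OF fT, of x]) (use x in simp)
  also have "\<dots> = - ?S" by (simp add: sum_negf)
  finally have "of_nat 2 * ?S = 0" by simp
  then show ?thesis using False by (simp add: mult_eq_0_iff)
qed

text \<open>Poisson summation in product form: expanding over the subsets \<open>X\<close> of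
  \<open>U\<close> leaves one character sum for each \<open>X\<close>, and only dual words survive.
  The counts below arise by choosing \<open>a\<close> and \<open>b\<close>.\<close>

lemma sum_prod_chi:
  fixes a b :: "'a \<Rightarrow> 'b::{idom,ring_char_0}"
  assumes "U \<subseteq> V"
  shows "(\<Sum>c\<in>F. \<Prod>i\<in>U. b i * chi i c + a i)
    = of_nat (card F) * (\<Sum>X\<in>Pow U \<inter> dual. (\<Prod>i\<in>X. b i) * (\<Prod>i\<in>U - X. a i))"
proof -
  have fU: "finite U" using assms finV finite_subset by blast
  have "(\<Sum>c\<in>F. \<Prod>i\<in>U. b i * chi i c + a i)
    = (\<Sum>X\<in>Pow U. \<Sum>c\<in>F. (\<Prod>i\<in>X. b i * chi i c) * (\<Prod>i\<in>U - X. a i))"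
    by (subst sum.swap) (simp add: prod_add fU)
  also have "\<dots> = (\<Sum>X\<in>Pow U. (\<Prod>i\<in>X. b i) * (\<Prod>i\<in>U - X. a i) * (\<Sum>c\<in>F. \<Prod>i\<in>X. chi i c))"
    by (simp add: sum_distrib_left prod.distrib mult_ac)
  also have "\<dots> = (\<Sum>X\<in>Pow U. if X \<in> dual
      then of_nat (card F) * ((\<Prod>i\<in>X. b i) * (\<Prod>i\<in>U - X. a i)) else 0)"
    using assms by (intro sum.cong) (auto simp: sum_character)
  also have "\<dots> = (\<Sum>X\<in>Pow U \<inter> dual. of_nat (card F) * ((\<Prod>i\<in>X. b i) * (\<Prod>i\<in>U - X. a i)))"
    using fU by (simp add: sum.inter_restrict)
  finally show ?thesis by (simp add: sum_distrib_left)
qed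

lemma card_mult_card_dual: "card F * card dual = 2 ^ card V"
proof -
  have D: "Pow V \<inter> dual = dual" using dual_subset by auto
  \<comment> \<open>With all coefficients 1 the dual side counts words, while each product has a
    factor 0 at any point of \<open>c\<close>.\<close>
  have "int (card F * card dual) = (\<Sum>c\<in>F. \<Prod>i\<in>V. 1 * chi i c + 1)"
    by (subst sum_prod_chi[OF order_refl]) (simp add: D)
  also have "\<dots> = (\<Sum>c\<in>F. if c = {} then 2 ^ card V else 0)"
  proof (rule sum.cong)
    fix c assume c: "c \<in> F"
    show "(\<Prod>i\<in>V. 1 * chi i c + 1) = (if c = {} then 2 ^ card V else 0 :: int)"
    proof (cases "c = {}")
      case False
      then obtain i where "i \<in> c" "i \<in> V" using c subV by blast
      then show ?thesis using False finV by (auto simp: chi_def intro!: prod_zero bexI[of _ i])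
    qed (simp add: chi_def)
  qed simp
  also have "\<dots> = 2 ^ card V" using finF empty_mem by simp
  finally show ?thesis by (metis of_nat_eq_iff of_nat_numeral of_nat_power)
qed

text \<open>The signs \<open>b\<close> make each factor 2 where \<open>c\<close> has the prescribed
  value and 0 where it does not, so the product detects the pattern.\<close>

lemma card_pattern:
  assumes "A \<subseteq> V" "B \<subseteq> V" "A \<inter> B = {}"
  shows "int (card {c\<in>F. c \<inter> A = {} \<and> B \<subseteq> c}) * 2 ^ card (A \<union> B)
    = int (card F) * (\<Sum>X\<in>Pow (A \<union> B) \<inter> dual. (-1) ^ card (X \<inter> B))"
proof -
  define U where "U = A \<union> B"
  have U: "U \<subseteq> V" "finite U" "finite A" "finite B"
    using assms finV finite_subset by (auto simp: U_def)
  define b :: "'a \<Rightarrow> int" where "b i = (if i \<in> B then - 1 else 1)" for i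
  have b: "(\<Prod>i\<in>X. b i) = (-1) ^ card (X \<inter> B)" if "X \<subseteq> U" for X
  proof -
    have "b i = chi i B" for i by (simp add: b_def chi_def)
    moreover have "finite X" using that U finite_subset by blast
    ultimately show ?thesis by (simp add: prod_chi Int_commute)
  qed
  have "(\<Prod>i\<in>U. b i * chi i c + 1) = (if c \<inter> A = {} \<and> B \<subseteq> c then 2 ^ card U else 0)" if "c \<in> F" for c
  proof (cases "c \<inter> A = {} \<and> B \<subseteq> c")
    case True
    then have "b i * chi i c + 1 = 2" if "i \<in> U" for i
      using that by (auto simp: b_def chi_def U_def)
    then show ?thesis using True by simp
  next
    case False
    then obtain i where "i \<in> c \<inter> A \<or> i \<in> B - c" by blast
    then have "i \<in> U" "b i * chi i c + 1 = 0"
      using assms(3) by (auto simp: b_def chi_def U_def)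
    then have "(\<Prod>i\<in>U. b i * chi i c + 1) = 0" using U(2) by (metis prod_zero)
    then show ?thesis using False by simp
  qed
  then have "(\<Sum>c\<in>F. \<Prod>i\<in>U. b i * chi i c + 1)
      = (\<Sum>c\<in>F. if c \<inter> A = {} \<and> B \<subseteq> c then 2 ^ card U else 0)"
    by (intro sum.cong) auto
  also have "\<dots> = int (card {c\<in>F. c \<inter> A = {} \<and> B \<subseteq> c}) * 2 ^ card U"
    using finF by (simp add: sum.If_cases Int_def)
  finally show ?thesis
    unfolding U_def[symmetric] by (subst (asm) sum_prod_chi[OF U(1)]) (simp add: b)
qed

text \<open>Only the zero dual word fits inside \<open>A \<union> B\<close>, so the sum in
  \<open>card_pattern\<close> is 1.\<close>

lemma card_pattern_strength:
  assumes "strength k" "A \<subseteq> V" "B \<subseteq> V" "A \<inter> B = {}" "card (A \<union> B) \<le> k"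
  shows "card {c\<in>F. c \<inter> A = {} \<and> B \<subseteq> c} * 2 ^ card (A \<union> B) = card F"
proof -
  have "X = {}" if "X \<in> dual" "X \<subseteq> A \<union> B" for X
  proof (rule ccontr)
    assume "X \<noteq> {}"
    then have "k < card X" using that assms(1) by (auto simp: strength_def)
    moreover have "card X \<le> card (A \<union> B)"
      using that assms(2,3) finV by (meson card_mono finite_subset le_sup_iff)
    ultimately show False using assms(5) by simp
  qed
  then have "Pow (A \<union> B) \<inter> dual = {{}}" using empty_mem_dual by auto
  then have "int (card {c\<in>F. c \<inter> A = {} \<and> B \<subseteq> c} * 2 ^ card (A \<union> B)) = int (card F)"
    using card_pattern[OF assms(2-4)] by simp
  then show ?thesis by (simp only: of_nat_eq_iff)
qed

lemma ex_pattern: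
  assumes "strength k" "A \<subseteq> V" "B \<subseteq> V" "A \<inter> B = {}" "card (A \<union> B) \<le> k"
  obtains c where "c \<in> F" "c \<inter> A = {}" "B \<subseteq> c"
proof -
  have "card {c\<in>F. c \<inter> A = {} \<and> B \<subseteq> c} \<noteq> 0"
    using card_pattern_strength[OF assms] card_F_pos by (metis mult_0 less_irrefl)
  then have "{c\<in>F. c \<inter> A = {} \<and> B \<subseteq> c} \<noteq> {}" by (metis card.empty)
  then show ?thesis using that by blast
qed

text \<open>Double counting of pairs of a word avoiding \<open>T\<close> and a
  \<open>j\<close>-subset \<open>X\<close> of it: a fixed \<open>X\<close> prescribes a pattern on
  \<open>card T + j\<close> coordinates.\<close>

lemma binomial_moment:
  assumes "strength k" "T \<subseteq> V" "card T + j \<le> k"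
  shows "(\<Sum>c | c \<in> F \<and> c \<inter> T = {}. card c choose j) * 2 ^ (card T + j)
    = card F * (card (V - T) choose j)"
proof -
  let ?G = "{c. c \<in> F \<and> c \<inter> T = {}}" and ?J = "{X. X \<subseteq> V - T \<and> card X = j}"
  have fJ: "finite ?J" using finV by simp
  have fG: "finite ?G" using finF by simp
  have "(\<Sum>c\<in>?G. card c choose j) = (\<Sum>c\<in>?G. \<Sum>X\<in>?J. if X \<subseteq> c then 1 else 0)"
  proof (rule sum.cong)
    fix c assume c: "c \<in> ?G"
    then have "{X. X \<subseteq> c \<and> card X = j} = {X \<in> ?J. X \<subseteq> c}" using subV by blast
    then have "card c choose j = card {X \<in> ?J. X \<subseteq> c}"
      using n_subsets[of c j] finite_word c by simp
    also have "\<dots> = (\<Sum>X\<in>?J. if X \<subseteq> c then 1 else 0)"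
      using fJ by (simp add: sum.If_cases Int_def)
    finally show "card c choose j = (\<Sum>X\<in>?J. if X \<subseteq> c then 1 else 0)" .
  qed simp
  also have "\<dots> = (\<Sum>X\<in>?J. \<Sum>c\<in>?G. if X \<subseteq> c then 1 else 0)" by (rule sum.swap)
  also have "\<dots> = (\<Sum>X\<in>?J. card {c\<in>F. c \<inter> T = {} \<and> X \<subseteq> c})"
    using fG by (intro sum.cong) (auto simp: sum.If_cases intro!: arg_cong[where f = card])
  finally have "(\<Sum>c\<in>?G. card c choose j) * 2 ^ (card T + j)
      = (\<Sum>X\<in>?J. card {c\<in>F. c \<inter> T = {} \<and> X \<subseteq> c} * 2 ^ (card T + j))"
    by (simp add: sum_distrib_right)
  also have "\<dots> = (\<Sum>X\<in>?J. card F)"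
  proof (rule sum.cong)
    fix X assume X: "X \<in> ?J"
    have "finite T" "finite X" using X assms(2) finV finite_subset by blast+
    then have "card (T \<union> X) = card T + j" using X by (subst card_Un_disjoint) auto
    then show "card {c\<in>F. c \<inter> T = {} \<and> X \<subseteq> c} * 2 ^ (card T + j) = card F"
      using card_pattern_strength[OF assms(1,2), of X] X assms(3) by auto
  qed simp
  also have "\<dots> = card F * (card (V - T) choose j)"
    using n_subsets[of "V - T" j] finV by simp
  finally show ?thesis .
qed

end

section \<open>From binomial moments to polynomial moments\<close>

lemma real_choose_Suc:
  "real (Suc j) * real (x choose Suc j) = (real x - real j) * real (x choose j)"
proof (cases "j \<le> x")
  case True
  have "(x choose j) * (x - j) = (x choose Suc j) * Suc j"
    by (metis binomial_absorb_comp binomial_absorption mult.commute)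
  then have "real (x choose j) * real (x - j) = real (Suc j) * real (x choose Suc j)"
    by (metis of_nat_mult mult.commute)
  then show ?thesis using True by (simp add: of_nat_diff algebra_simps)
qed (simp add: binomial_eq_0)

text \<open>The binomials \<open>x choose j\<close> with \<open>j < K\<close> span the polynomials
  of degree below \<open>K\<close>.\<close>

lemma sum_poly_eq_0_of_binomial_moments:
  fixes f :: "'i \<Rightarrow> real"
  assumes "finite I" and mom: "\<And>j. j < K \<Longrightarrow> (\<Sum>i\<in>I. f i * real (g i choose j)) = 0"
    and deg: "degree p < K"
  shows "(\<Sum>i\<in>I. f i * poly p (real (g i))) = 0"
proof -
  have step: "real x * real (x choose j) = real (Suc j) * real (x choose Suc j) + real j * real (x choose j)"
    for x j
    by (simp only: real_choose_Suc left_diff_distrib)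
  \<comment> \<open>Powers are generalised to powers times binomials: \<open>step\<close> trades a
    factor \<open>g i\<close> for a larger \<open>j\<close>, and \<open>j + k\<close> never
    grows.\<close>
  have pow: "(\<Sum>i\<in>I. f i * (real (g i) ^ k * real (g i choose j))) = 0" if "j + k < K" for j k
    using that
  proof (induction k arbitrary: j)
    case 0
    then show ?case using mom by simp
  next
    case (Suc k)
    have "(\<Sum>i\<in>I. f i * (real (g i) ^ Suc k * real (g i choose j)))
      = real (Suc j) * (\<Sum>i\<in>I. f i * (real (g i) ^ k * real (g i choose Suc j)))
        + real j * (\<Sum>i\<in>I. f i * (real (g i) ^ k * real (g i choose j)))"
    proof -
      have "f i * (real (g i) ^ Suc k * real (g i choose j))
        = f i * real (g i) ^ k * (real (g i) * real (g i choose j))" for i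
        by (simp add: mult_ac)
      then show ?thesis
        by (simp only: step) (simp add: sum_distrib_left sum.distrib[symmetric] algebra_simps)
    qed
    then show ?case using Suc.IH[of "Suc j"] Suc.IH[of j] Suc.prems by simp
  qed
  have "(\<Sum>i\<in>I. f i * poly p (real (g i)))
      = (\<Sum>k\<le>degree p. coeff p k * (\<Sum>i\<in>I. f i * (real (g i) ^ k * real (g i choose 0))))"
    by (simp add: poly_altdef sum_distrib_left mult_ac, subst sum.swap, simp)
  also have "\<dots> = 0"
    using deg by (intro sum.neutral ballI) (subst pow, auto)
  finally show ?thesis .
qed

subsection \<open>Small weights\<close>

context set_code
begin

text \<open>The whole space \<open>Pow V\<close> has zero dual, hence every strength, so its
  normalised binomial moments up to \<open>k\<close> are those of \<open>F\<close>.\<close>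

lemma poly_moment:
  assumes "strength k" "degree p \<le> k"
  shows "(\<Sum>c\<in>F. poly p (real (card c))) * 2 ^ card V
    = real (card F) * (\<Sum>c\<in>Pow V. poly p (real (card c)))"
proof -
  interpret full: set_code V "Pow V"
    by unfold_locales (use finV in auto)
  have "y = {}" if "y \<in> full.dual" for y
  proof (rule ccontr)
    assume "y \<noteq> {}"
    then obtain i where "i \<in> y" by blast
    then show False using full.dual_even[OF that, of "{i}"] full.dual_subset[OF that] by auto
  qed
  then have full: "full.strength k" by (auto simp: full.strength_def)
  \<comment> \<open>One signed weighting of \<open>Pow V\<close> carries both sums, with the
    denominators cleared.\<close>
  define f where "f c = of_bool (c \<in> F) * 2 ^ card V - real (card F)" for c
  have split: "(\<Sum>c\<in>Pow V. f c * h c) = (\<Sum>c\<in>F. h c) * 2 ^ card V - real (card F) * (\<Sum>c\<in>Pow V. h c)" for h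
  proof -
    have "Pow V \<inter> F = F" using subV by blast
    then have "(\<Sum>c\<in>Pow V. of_bool (c \<in> F) * h c) = (\<Sum>c\<in>F. h c)"
      using finV by simp
    moreover have "f c * h c = 2 ^ card V * (of_bool (c \<in> F) * h c) - real (card F) * h c" for c
      by (simp add: f_def algebra_simps)
    ultimately show ?thesis
      by (simp only: sum_subtractf flip: sum_distrib_left) (simp only: mult.commute)
  qed
  have "(\<Sum>c\<in>Pow V. f c * poly p (real (card c))) = 0"
  proof (rule sum_poly_eq_0_of_binomial_moments[where K = "Suc k"])
    fix j assume "j < Suc k"
    then have "(\<Sum>c\<in>F. card c choose j) * 2 ^ j = card F * (card V choose j)"
        and "(\<Sum>c\<in>Pow V. card c choose j) * 2 ^ j = 2 ^ card V * (card V choose j)"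
      using binomial_moment[OF assms(1), of "{}" j] full.binomial_moment[OF full, of "{}" j]
      by (simp_all add: card_Pow finV flip: Pow_def)
    then have "real ((\<Sum>c\<in>F. card c choose j) * 2 ^ j) = real (card F * (card V choose j))"
        and "real ((\<Sum>c\<in>Pow V. card c choose j) * 2 ^ j) = real (2 ^ card V * (card V choose j))"
      by presburger+
    then have "((\<Sum>c\<in>F. real (card c choose j)) * 2 ^ card V) * 2 ^ j
        = (real (card F) * (\<Sum>c\<in>Pow V. real (card c choose j))) * 2 ^ j"
      by (simp add: mult.assoc mult.left_commute mult.commute)
    then show "(\<Sum>c\<in>Pow V. f c * real (card c choose j)) = 0"
      by (simp add: split)
  qed (use finV assms(2) in auto)
  then show ?thesis by (simp add: split)
qed

text \<open>The degree-(s-1) polynomial vanishing on all the other small weights isolates one weight: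
  this is the Assmus--Mattson argument.\<close>

lemma card_avoiding_eq:
  assumes str: "strength k" and "finite S" "u \<in> S" "0 < u" "t + card S \<le> k + 1"
    and wts: "\<And>c. c \<in> F \<Longrightarrow> c \<noteq> {} \<Longrightarrow> card c \<le> card V - t \<Longrightarrow> card c \<in> S"
    and T: "T \<subseteq> V" "card T = t" and T': "T' \<subseteq> V" "card T' = t"
  shows "card {c\<in>F. card c = u \<and> c \<inter> T = {}} = card {c\<in>F. card c = u \<and> c \<inter> T' = {}}"
proof -
  \<comment> \<open>Words avoiding \<open>T\<close> and words avoiding \<open>T'\<close> have equal
    binomial moments of order at most \<open>k - t\<close>, which covers all orders below
    \<open>card S\<close>; so \<open>f\<close> annihilates \<open>p\<close>.\<close>
  define f where "f c = of_bool (c \<inter> T = {}) - (of_bool (c \<inter> T' = {}) :: real)" for c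
  define p where "p = (\<Prod>w\<in>S - {u}. [:- real w, 1:])"
  have split: "(\<Sum>c\<in>F. f c * h c)
      = (\<Sum>c | c \<in> F \<and> c \<inter> T = {}. h c) - (\<Sum>c | c \<in> F \<and> c \<inter> T' = {}. h c)" for h
    using finF by (simp add: f_def left_diff_distrib sum_subtractf Int_def)
  have "degree p = card S - 1"
    unfolding p_def using assms(2,3) by (subst degree_prod_eq_sum_degree) auto
  moreover have "0 < card S" using assms(2,3) card_gt_0_iff by blast
  ultimately have deg: "degree p < card S" by simp
  have "(\<Sum>c\<in>F. f c * poly p (real (card c))) = 0"
  proof (rule sum_poly_eq_0_of_binomial_moments[where K = "card S"])
    fix j assume "j < card S"
    then have j: "t + j \<le> k" using assms(5) by simp
    have card: "card (V - T) = card (V - T')"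
      using T T' finV by (simp add: card_Diff_subset finite_subset)
    have "(\<Sum>c | c \<in> F \<and> c \<inter> T = {}. card c choose j) * 2 ^ (t + j)
        = (\<Sum>c | c \<in> F \<and> c \<inter> T' = {}. card c choose j) * 2 ^ (t + j)"
      using binomial_moment[OF str T(1), of j] binomial_moment[OF str T'(1), of j] T T' j
      by (simp add: card)
    then have "(\<Sum>c | c \<in> F \<and> c \<inter> T = {}. card c choose j)
        = (\<Sum>c | c \<in> F \<and> c \<inter> T' = {}. card c choose j)" by simp
    then show "(\<Sum>c\<in>F. f c * real (card c choose j)) = 0"
      by (simp only: split flip: of_nat_sum)
  qed (use finF deg in auto)
  moreover have isolate: "f c * poly p (real (card c)) = poly p (real u) * (of_bool (card c = u) * f c)"
    if c: "c \<in> F" for c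
  proof (cases "c = {} \<or> card c = u")
    case True
    \<comment> \<open>The zero word avoids both sets, so \<open>f\<close> is 0 there and
      \<open>p\<close> need not vanish at 0.\<close>
    then show ?thesis using \<open>0 < u\<close> by (auto simp: f_def)
  next
    case False
    have "f c = 0 \<or> poly p (real (card c)) = 0"
    proof (cases "c \<inter> T = {} \<or> c \<inter> T' = {}")
      case True
      \<comment> \<open>A word avoiding a \<open>t\<close>-set lives on the remaining points, so its
        weight is one of those in \<open>S\<close>.\<close>
      have "card c \<le> card V - t"
      proof -
        have "c \<subseteq> V - T \<or> c \<subseteq> V - T'" using True subV[OF c] by blast
        then have "card c \<le> card (V - T) \<or> card c \<le> card (V - T')"
          using finV by (meson card_mono finite_Diff)
        then show ?thesis
          using T T' finV by (simp add: card_Diff_subset finite_subset)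
      qed
      then have "card c \<in> S - {u}" using wts c False by blast
      then have "poly p (real (card c)) = 0"
        using \<open>finite S\<close> by (auto simp: p_def poly_prod)
      then show ?thesis ..
    qed (simp add: f_def)
    then show ?thesis using False by auto
  qed
  ultimately have "poly p (real u) * (\<Sum>c\<in>F. of_bool (card c = u) * f c) = 0"
    by (simp add: isolate sum_distrib_left)
  moreover have "poly p (real u) \<noteq> 0"
    using \<open>finite S\<close> by (auto simp: p_def poly_prod)
  ultimately have "(\<Sum>c\<in>F. of_bool (card c = u) * f c) = 0" by simp
  then have "(\<Sum>c | c \<in> F \<and> c \<inter> T = {}. of_bool (card c = u))
      = (\<Sum>c | c \<in> F \<and> c \<inter> T' = {}. of_bool (card c = u) :: real)"
    by (simp add: split mult.commute[of "of_bool _"] del: sum_of_bool_eq sum_mult_of_bool_eq sum_of_bool_mult_eq)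
  moreover have "{c \<in> F. c \<inter> X = {}} \<inter> {c. card c = u} = {c\<in>F. card c = u \<and> c \<inter> X = {}}" for X
    by auto
  ultimately show ?thesis using finF by simp
qed

end

section \<open>Blocks of a design that avoid or contain prescribed points\<close>

lemma design_avoiding:
  assumes "finite V" and B: "\<And>b. b \<in> \<B> \<Longrightarrow> b \<subseteq> V \<and> card b = u"
    and "t + u \<le> card V" "e \<le> t"
    and const: "\<And>T T'. T \<subseteq> V \<Longrightarrow> T' \<subseteq> V \<Longrightarrow> card T = t \<Longrightarrow> card T' = t \<Longrightarrow>
      card {b\<in>\<B>. b \<inter> T = {}} = card {b\<in>\<B>. b \<inter> T' = {}}"
  shows "T \<subseteq> V \<Longrightarrow> T' \<subseteq> V \<Longrightarrow> card T = e \<Longrightarrow> card T' = e \<Longrightarrow>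
      card {b\<in>\<B>. b \<inter> T = {}} = card {b\<in>\<B>. b \<inter> T' = {}}"
  using \<open>e \<le> t\<close>
proof (induction e arbitrary: T T' rule: inc_induct)
  case base
  then show ?case using const by blast
next
  case (step e)
  have finB: "finite \<B>"
    using B \<open>finite V\<close> by (meson PowI finite_Pow_iff finite_subset subsetI)
  \<comment> \<open>Double counting of pairs of a block avoiding \<open>X\<close> and a further
    point off that block.\<close>
  have count: "(\<Sum>x\<in>V - X. card {b\<in>\<B>. b \<inter> insert x X = {}})
      = card {b\<in>\<B>. b \<inter> X = {}} * (card V - e - u)" if X: "X \<subseteq> V" "card X = e" for X
  proof -
    let ?G = "{b\<in>\<B>. b \<inter> X = {}}"
    have "(\<Sum>x\<in>V - X. card {b\<in>\<B>. b \<inter> insert x X = {}})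
        = (\<Sum>x\<in>V - X. \<Sum>b\<in>?G. if x \<in> b then 0 else 1)"
      using finB by (intro sum.cong) (auto simp: sum.If_cases intro!: arg_cong[where f = card])
    also have "\<dots> = (\<Sum>b\<in>?G. \<Sum>x\<in>V - X. if x \<in> b then 0 else 1)" by (rule sum.swap)
    also have "\<dots> = (\<Sum>b\<in>?G. card V - e - u)"
    proof (rule sum.cong)
      fix b assume b: "b \<in> ?G"
      have "(\<Sum>x\<in>V - X. if x \<in> b then 0 else 1) = card (V - X - b)"
        using \<open>finite V\<close> by (auto simp: sum.If_cases intro!: arg_cong[where f = card])
      also have "\<dots> = card (V - X) - card b"
        using b B \<open>finite V\<close> by (intro card_Diff_subset) (blast intro: finite_subset)+
      also have "\<dots> = card V - e - u"
        using b B X \<open>finite V\<close> by (simp add: card_Diff_subset finite_subset)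
      finally show "(\<Sum>x\<in>V - X. if x \<in> b then 0 else 1) = card V - e - u" .
    qed simp
    finally show ?thesis by simp
  qed
  obtain T0 where T0: "T0 \<subseteq> V" "card T0 = Suc e"
    using obtain_subset_with_card_n[of "Suc e" V] step.hyps assms(3) by force
  have "(\<Sum>x\<in>V - X. card {b\<in>\<B>. b \<inter> insert x X = {}})
      = (card V - e) * card {b\<in>\<B>. b \<inter> T0 = {}}" if X: "X \<subseteq> V" "card X = e" for X
  proof -
    have "finite X" using X \<open>finite V\<close> finite_subset by blast
    then have "(\<Sum>x\<in>V - X. card {b\<in>\<B>. b \<inter> insert x X = {}})
      = (\<Sum>x\<in>V - X. card {b\<in>\<B>. b \<inter> T0 = {}})"
      using X T0 by (intro sum.cong step.IH) auto
    then show ?thesis using X \<open>finite X\<close> by (simp add: card_Diff_subset)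
  qed
  then have "card {b\<in>\<B>. b \<inter> T = {}} * (card V - e - u) = card {b\<in>\<B>. b \<inter> T' = {}} * (card V - e - u)"
    using count[of T] count[of T'] step.prems by simp
  \<comment> \<open>The factor \<open>card V - e - u\<close> is positive, since \<open>e < t\<close>
    and \<open>t + u \<le> card V\<close>, and cancels.\<close>
  then show ?case using step.hyps assms(3) by simp
qed

text \<open>Containment is traded for avoidance: blocks containing \<open>X\<close> and avoiding
  \<open>E\<close> split by whether they contain a further point \<open>x\<close>. As
  \<open>a + e\<close> does not grow, no avoided set exceeds \<open>t\<close> points.\<close>

lemma design_pattern:
  assumes "finite V" and B: "\<And>b. b \<in> \<B> \<Longrightarrow> b \<subseteq> V \<and> card b = u"
    and "t + u \<le> card V"
    and const: "\<And>T T'. T \<subseteq> V \<Longrightarrow> T' \<subseteq> V \<Longrightarrow> card T = t \<Longrightarrow> card T' = t \<Longrightarrow>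
      card {b\<in>\<B>. b \<inter> T = {}} = card {b\<in>\<B>. b \<inter> T' = {}}"
    and "a + e \<le> t"
  shows "A \<union> E \<subseteq> V \<Longrightarrow> A' \<union> E' \<subseteq> V \<Longrightarrow> A \<inter> E = {} \<Longrightarrow> A' \<inter> E' = {} \<Longrightarrow>
      card A = a \<Longrightarrow> card A' = a \<Longrightarrow> card E = e \<Longrightarrow> card E' = e \<Longrightarrow>
      card {b\<in>\<B>. A \<subseteq> b \<and> b \<inter> E = {}} = card {b\<in>\<B>. A' \<subseteq> b \<and> b \<inter> E' = {}}"
  using \<open>a + e \<le> t\<close>
proof (induction a arbitrary: A A' E E' e)
  case 0
  have "finite A" "finite A'" using "0.prems"(1,2) \<open>finite V\<close> by (auto intro: finite_subset)
  then have "A = {}" "A' = {}" using "0.prems" by auto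
  moreover have "card {b\<in>\<B>. b \<inter> E = {}} = card {b\<in>\<B>. b \<inter> E' = {}}"
    by (rule design_avoiding[OF assms(1-3) _ const, where e = e]) (use "0.prems" in auto)
  ultimately show ?case by simp
next
  case (Suc a)
  have finB: "finite \<B>"
    using B \<open>finite V\<close> by (meson PowI finite_Pow_iff finite_subset subsetI)
  obtain x X where x: "A = insert x X" "x \<notin> X" "card X = a"
    using Suc.prems(5) card_Suc_eq[of A a] by blast
  obtain y Y where y: "A' = insert y Y" "y \<notin> Y" "card Y = a"
    using Suc.prems(6) card_Suc_eq[of A' a] by blast
  have fin: "finite E" "finite E'" using Suc.prems(1,2) \<open>finite V\<close> by (auto intro: finite_subset)
  have split: "card {b\<in>\<B>. X \<subseteq> b \<and> b \<inter> E = {}}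
      = card {b\<in>\<B>. insert x X \<subseteq> b \<and> b \<inter> E = {}} + card {b\<in>\<B>. X \<subseteq> b \<and> b \<inter> insert x E = {}}" for x X E
    using finB by (subst card_Un_disjoint[symmetric]) (auto intro!: arg_cong[where f = card])
  have "card {b\<in>\<B>. X \<subseteq> b \<and> b \<inter> E = {}} = card {b\<in>\<B>. Y \<subseteq> b \<and> b \<inter> E' = {}}"
    using Suc.prems x y by (intro Suc.IH[of _ _ _ _ e]) auto
  moreover have "card {b\<in>\<B>. X \<subseteq> b \<and> b \<inter> insert x E = {}} = card {b\<in>\<B>. Y \<subseteq> b \<and> b \<inter> insert y E' = {}}"
    using Suc.prems x y fin by (intro Suc.IH[of _ _ _ _ "Suc e"]) auto
  ultimately show ?case using split[of X E x] split[of Y E' y] x y by simp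
qed

section \<open>Codes with the all-one word: bounds on strength and on weights\<close>

locale ones_code = set_code +
  assumes V_mem: "V \<in> F"
begin

definition inner :: "nat set"
  where "inner = {w. 0 < w \<and> w < card V \<and> (\<exists>c\<in>F. card c = w)}"

lemma finite_inner: "finite inner"
  by (rule finite_subset[of _ "{..<card V}"]) (auto simp: inner_def)

lemma compl_mem: "c \<in> F \<Longrightarrow> V - c \<in> F"
  using sym_diff_mem[OF V_mem, of c] subV[of c] by (simp add: Un_absorb2 Diff_eq_empty_iff[THEN iffD2])

lemma card_compl: "c \<in> F \<Longrightarrow> card (V - c) = card V - card c"
  by (meson card_Diff_subset finite_word subV)

lemma inner_compl: "w \<in> inner \<Longrightarrow> card V - w \<in> inner"
  using compl_mem card_compl by (fastforce simp: inner_def)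

lemma card_inner_mem: "c \<in> F \<Longrightarrow> c \<noteq> {} \<Longrightarrow> c \<noteq> V \<Longrightarrow> card c \<in> inner"
  using subV finV by (auto simp: inner_def card_gt_0_iff finite_word intro!: psubset_card_mono)

lemma even_card_dual: "y \<in> dual \<Longrightarrow> even (card y)"
  using dual_even[OF _ V_mem] dual_subset by (simp add: Int_absorb1)

text \<open>Otherwise \<open>poly_moment\<close> applies to the nonnegative polynomial
  \<open>p\<close>, which vanishes at all weights of \<open>F\<close>. Its average over the whole
  space is then 0, so it vanishes at every integer from 0 to \<open>card V\<close>; all those
  strictly between are inner weights, which are too many.\<close>

lemma strength_le:
  assumes "strength k" "k < card V"
  shows "k \<le> 2 * card inner + 1"
proof (rule ccontr)
  assume "\<not> k \<le> 2 * card inner + 1"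
  then have k: "2 * card inner + 2 \<le> k" by simp
  define n where "n = card V"
  define p where "p = [:0, 1:] * [:real n, -1:] * (\<Prod>w\<in>inner. [:- real w, 1:]) ^ 2"
  have p: "poly p x = x * (real n - x) * (\<Prod>w\<in>inner. x - real w) ^ 2" for x
    by (simp add: p_def poly_prod algebra_simps)
  have "degree p \<le> 2 * card inner + 2"
  proof -
    have q: "degree (\<Prod>w\<in>inner. [:- real w, 1:]) \<le> card inner"
      by (subst degree_prod_eq_sum_degree) auto
    have "degree ((\<Prod>w\<in>inner. [:- real w, 1:]) ^ 2) \<le> 2 * card inner"
      using degree_power_le[of "\<Prod>w\<in>inner. [:- real w, 1:]" 2] q by (simp add: mult.commute)
    moreover have "degree ([:0, 1:] * [:real n, -1:]) \<le> 2"
      using degree_mult_le[of "[:0, 1::real:]" "[:real n, -1:]"] by simp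
    ultimately show ?thesis
      unfolding p_def using degree_mult_le order_trans by (metis (no_types, lifting) add.commute add_mono)
  qed
  then have "(\<Sum>c\<in>F. poly p (real (card c))) * 2 ^ card V
      = real (card F) * (\<Sum>c\<in>Pow V. poly p (real (card c)))"
    using poly_moment[OF assms(1)] k by simp
  moreover have "poly p (real (card c)) = 0" if "c \<in> F" for c
  proof -
    have "c = {} \<or> c = V \<or> card c \<in> inner" using card_inner_mem that by blast
    then show ?thesis using finite_inner by (auto simp: p n_def)
  qed
  ultimately have "(\<Sum>c\<in>Pow V. poly p (real (card c))) = 0"
    using card_F_pos by simp
  moreover have "0 \<le> poly p (real (card c))" if "c \<in> Pow V" for c
    using that finV by (auto simp: p n_def card_mono)
  ultimately have zero: "poly p (real (card c)) = 0" if "c \<in> Pow V" for c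
    using that finV by (subst (asm) sum_nonneg_eq_0_iff) auto
  have "{0<..<n} \<subseteq> inner"
  proof
    fix w assume w: "w \<in> {0<..<n}"
    then obtain c where "c \<subseteq> V" "card c = w"
      using obtain_subset_with_card_n[of w V] by (auto simp: n_def)
    then have "poly p (real w) = 0" using zero by blast
    then show "w \<in> inner" using w finite_inner by (auto simp: p)
  qed
  then have "card {0<..<n} \<le> card inner" using card_mono finite_inner by blast
  then show False using k assms(2) by (simp add: n_def)
qed

lemma inner_le:
  assumes str: "strength k" and S: "S = {u. (\<exists>c\<in>F. card c = u) \<and> 0 < u \<and> u \<le> card V - t}"
    and k: "k + 1 = t + card S" and "S \<noteq> {}" and "0 < t" and y: "y \<in> dual" "card y = k + 1"
    and w: "w \<in> inner"
  shows "w \<le> card V - t"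
proof (rule ccontr)
  assume nw: "\<not> w \<le> card V - t"
  have "finite S" using S by (auto intro: finite_subset[of _ "{..card V - t}"])
  then have "0 < card S" using \<open>S \<noteq> {}\<close> by (simp add: card_gt_0_iff)
  have "k + 1 \<le> card V" using y dual_subset finV by (metis card_mono)
  define m where "m = (LEAST m. m \<in> inner)"
  have m: "m \<in> inner" unfolding m_def using w by (rule LeastI)
  have mle: "m \<le> v" if "v \<in> inner" for v unfolding m_def using that by (rule Least_le)
  have "S \<subseteq> inner" using S \<open>0 < t\<close> \<open>k + 1 \<le> card V\<close> by (auto simp: inner_def)
  then obtain v where "v \<in> S" "m \<le> v" using \<open>S \<noteq> {}\<close> mle by blast
  then have mS: "m \<in> S" using S m by (auto simp: inner_def)
  have "w < card V" using w by (simp add: inner_def)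
  \<comment> \<open>The complement of a word of weight \<open>w\<close> has weight below
    \<open>t\<close>.\<close>
  then have mt: "m < t" using mle[OF inner_compl[OF w]] nw \<open>k + 1 \<le> card V\<close> k by linarith
  have mn: "0 < m" "m < card V" "t + m \<le> card V"
    using m mS S mt by (auto simp: inner_def)
  let ?B = "{c\<in>F. card c = m}"
  have const: "card {b\<in>?B. b \<inter> T = {}} = card {b\<in>?B. b \<inter> T' = {}}"
    if "T \<subseteq> V" "T' \<subseteq> V" "card T = t" "card T' = t" for T T'
  proof -
    have "card {c\<in>F. card c = m \<and> c \<inter> T = {}} = card {c\<in>F. card c = m \<and> c \<inter> T' = {}}"
      using that mS mn k
      by (intro card_avoiding_eq[OF str \<open>finite S\<close>, where t = t])
        (auto simp: S card_gt_0_iff finite_word)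
    moreover have "{b\<in>?B. b \<inter> X = {}} = {c\<in>F. card c = m \<and> c \<inter> X = {}}" for X by auto
    ultimately show ?thesis by simp
  qed
  \<comment> \<open>As \<open>m < t\<close>, constancy for avoided \<open>t\<close>-sets passes to
    contained \<open>m\<close>-sets; a block of size \<open>m\<close> containing \<open>A\<close>
    equals \<open>A\<close>.\<close>
  have all: "A \<in> F" if A: "A \<subseteq> V" "card A = m" for A
  proof -
    obtain c where c: "c \<in> F" "card c = m" using m by (auto simp: inner_def)
    have "card {b\<in>?B. A \<subseteq> b \<and> b \<inter> {} = {}} = card {b\<in>?B. c \<subseteq> b \<and> b \<inter> {} = {}}"
      using A c subV mt mn
      by (intro design_pattern[OF finV _ _ const, where a = m and e = 0]) auto
    moreover have "0 < card {b\<in>?B. c \<subseteq> b \<and> b \<inter> {} = {}}"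
      using c finF by (auto simp: card_gt_0_iff)
    ultimately have "{b\<in>?B. A \<subseteq> b \<and> b \<inter> {} = {}} \<noteq> {}"
      by (metis card.empty less_irrefl)
    then obtain b where b: "b \<in> F" "card b = m" "A \<subseteq> b" by auto
    then have "A = b" using A by (intro card_subset_eq) (auto simp: finite_word)
    then show ?thesis using b by simp
  qed
  \<comment> \<open>Two \<open>m\<close>-sets that differ in one point add up to the word
    \<open>{i, j}\<close>, which meets the dual word \<open>y\<close> evenly.\<close>
  have pair: "i \<in> y \<longleftrightarrow> j \<in> y" if ij: "i \<in> V" "j \<in> V" "i \<noteq> j" for i j
  proof -
    have "card (V - {i, j}) = card V - 2" using ij finV by (subst card_Diff_subset) auto
    then have "m - 1 \<le> card (V - {i, j})" using mn by linarith
    then obtain X where X: "X \<subseteq> V - {i, j}" "card X = m - 1" "finite X"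
      by (rule obtain_subset_with_card_n)
    then have fX: "finite X" "i \<notin> X" "j \<notin> X" by auto
    have "insert i X \<in> F" "insert j X \<in> F"
      using X fX ij mn by (auto intro!: all)
    then have "sym_diff (insert i X) (insert j X) \<in> F" by (rule sym_diff_mem)
    also have "sym_diff (insert i X) (insert j X) = {i, j}" using fX ij by auto
    finally have "even (card ({i, j} \<inter> y))" using dual_even y by blast
    then show ?thesis using ij by (auto simp: Int_insert_left split: if_splits)
  qed
  have "y = V"
  proof -
    obtain i where "i \<in> y" using y by fastforce
    then show ?thesis using pair dual_subset[OF y(1)] by blast
  qed
  \<comment> \<open>Now \<open>k + 1 = card V\<close>, so \<open>S\<close> has
    \<open>card V - t\<close> elements and contains 1; a word of weight 1 is not orthogonal to
    \<open>V\<close>.\<close>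
  then have "card {0<..card V - t} = card S" using y k \<open>k + 1 \<le> card V\<close> by simp
  moreover have "S \<subseteq> {0<..card V - t}" using S by auto
  ultimately have "S = {0<..card V - t}" by (intro card_subset_eq) auto
  then have "1 \<in> S" using \<open>S \<noteq> {}\<close> by auto
  then obtain c where c: "c \<in> F" "card c = 1" using S by auto
  then have "c \<inter> y = c" using subV \<open>y = V\<close> by blast
  then show False using dual_even[OF y(1) c(1)] c by simp
qed

end

section \<open>Second and fourth centred power moments\<close>

context set_code
begin

text \<open>The number \<open>card V - 2 * card c\<close> is a sum of \<open>card V\<close> signs,
  any four of which are independent and fair over \<open>F\<close>, so these are the moments of a
  simple random walk. The computation goes through the first four binomial moments.\<close>

lemma power_moments:
  assumes "strength 4"
  shows "(\<Sum>c\<in>F. (real (card V) - 2 * real (card c)) ^ 2) = real (card F) * real (card V)"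
    and "(\<Sum>c\<in>F. (real (card V) - 2 * real (card c)) ^ 4)
      = real (card F) * (3 * real (card V) ^ 2 - 2 * real (card V))"
proof -
  define n where "n = real (card V)"
  define N where "N = real (card F)"
  define e where "e j x = real (x choose j)" for j x
  have S: "(\<Sum>c\<in>F. e j (card c)) * 2 ^ j = N * e j (card V)" if "j \<le> 4" for j
    using arg_cong[OF binomial_moment[OF assms, of "{}" j], of real] that
    by (simp add: e_def N_def)
  have e1: "e (Suc 0) x = real x" for x by (simp add: e_def)
  have e2: "e 2 x = real x * (real x - 1) / 2" for x
    using real_choose_Suc[of 1 x] by (simp add: e_def numeral_2_eq_2 mult.commute)
  have e3: "e 3 x = real x * (real x - 1) * (real x - 2) / 6" for x
  proof -
    have "3 * e 3 x = (real x - 2) * e 2 x"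
      using real_choose_Suc[of 2 x] by (simp add: e_def numeral_3_eq_3 numeral_2_eq_2)
    then show ?thesis by (simp add: e2 field_simps)
  qed
  have e4: "e 4 x = real x * (real x - 1) * (real x - 2) * (real x - 3) / 24" for x
  proof -
    have "4 * e 4 x = (real x - 3) * e 3 x"
      using real_choose_Suc[of 3 x] by (simp add: e_def eval_nat_numeral)
    then show ?thesis by (simp add: e3 field_simps)
  qed
  have y2: "(n - 2 * real x) ^ 2 = n ^ 2 + (4 - 4 * n) * e (Suc 0) x + 8 * e 2 x" for x
    by (simp add: e1 e2 field_simps power2_eq_square)
  \<comment> \<open>The coefficient of \<open>e j x\<close> is the \<open>j\<close>-th forward
    difference of the left side at \<open>x = 0\<close>.\<close>
  have y4: "(n - 2 * real x) ^ 4 = n ^ 4 + (16 - 32 * n + 24 * n ^ 2 - 8 * n ^ 3) * e (Suc 0) x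
      + (224 - 192 * n + 48 * n ^ 2) * e 2 x + (576 - 192 * n) * e 3 x + 384 * e 4 x" for x
    by (simp add: e1 e2 e3 e4 field_simps power2_eq_square power3_eq_cube power4_eq_xxxx)
  have S1: "(\<Sum>c\<in>F. e (Suc 0) (card c)) = N * n / 2"
    using S[of "Suc 0"] e1[of "card V"] by (simp add: n_def)
  have S2: "(\<Sum>c\<in>F. e 2 (card c)) = N * (n * (n - 1)) / 8"
    using S[of 2] e2[of "card V"] by (simp add: n_def)
  have S3: "(\<Sum>c\<in>F. e 3 (card c)) = N * (n * (n - 1) * (n - 2)) / 48"
    using S[of 3] e3[of "card V"] by (simp add: n_def)
  have S4: "(\<Sum>c\<in>F. e 4 (card c)) = N * (n * (n - 1) * (n - 2) * (n - 3)) / 384"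
    using S[of 4] e4[of "card V"] by (simp add: n_def)
  have "(\<Sum>c\<in>F. (n - 2 * real (card c)) ^ 2)
      = N * n ^ 2 + (4 - 4 * n) * (\<Sum>c\<in>F. e (Suc 0) (card c)) + 8 * (\<Sum>c\<in>F. e 2 (card c))"
    by (simp only: y2 sum.distrib flip: sum_distrib_left) (simp add: N_def)
  also have "\<dots> = N * n"
    unfolding S1 S2 by (simp add: field_simps power2_eq_square)
  finally show "(\<Sum>c\<in>F. (n - 2 * real (card c)) ^ 2) = N * n" .
  have "(\<Sum>c\<in>F. (n - 2 * real (card c)) ^ 4)
      = N * n ^ 4 + (16 - 32 * n + 24 * n ^ 2 - 8 * n ^ 3) * (\<Sum>c\<in>F. e (Suc 0) (card c))
      + (224 - 192 * n + 48 * n ^ 2) * (\<Sum>c\<in>F. e 2 (card c))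
      + (576 - 192 * n) * (\<Sum>c\<in>F. e 3 (card c)) + 384 * (\<Sum>c\<in>F. e 4 (card c))"
    by (simp only: y4 sum.distrib flip: sum_distrib_left) (simp add: N_def)
  also have "\<dots> = N * (3 * n ^ 2 - 2 * n)"
    unfolding S1 S2 S3 S4
    by (simp add: field_simps power2_eq_square power3_eq_cube power4_eq_xxxx)
  finally show "(\<Sum>c\<in>F. (n - 2 * real (card c)) ^ 4) = N * (3 * n ^ 2 - 2 * n)" .
qed

end

subsection \<open>Two weights\<close>

text \<open>Both factors are powers of two, so the smaller divides the larger and hence their
  difference \<open>2 * a\<close>; this forces \<open>a * a + 2 \<le> 3 * a\<close>.\<close>

lemma small_of_power_of_two_factors:
  fixes a :: nat
  assumes "(a ^ 2 + 2 - a) * (a ^ 2 + a + 2) dvd 2 ^ m" "0 < a"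
  shows "a = 1 \<or> a = 2"
proof -
  have "a \<le> a ^ 2" using \<open>0 < a\<close> by (simp add: power2_eq_square)
  have two: "prime (2::nat)" by simp
  have "a ^ 2 + 2 - a dvd 2 ^ m" "a ^ 2 + a + 2 dvd 2 ^ m"
    using dvd_mult_left[OF assms(1)] dvd_mult_right[OF assms(1)] .
  then obtain i j where ij: "a ^ 2 + 2 - a = 2 ^ i" "a ^ 2 + a + 2 = 2 ^ j"
    using divides_primepow_nat[OF two] by metis
  have "(2::nat) ^ i \<le> 2 ^ j" unfolding ij[symmetric] by simp
  then have "i \<le> j" by simp
  then have "a ^ 2 + 2 - a dvd a ^ 2 + a + 2" unfolding ij by (rule le_imp_power_dvd)
  then have "a ^ 2 + 2 - a dvd (a ^ 2 + a + 2) - (a ^ 2 + 2 - a)" by (rule dvd_diff_nat) simp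
  also have "(a ^ 2 + a + 2) - (a ^ 2 + 2 - a) = 2 * a" using \<open>a \<le> a ^ 2\<close> by simp
  finally have "a ^ 2 + 2 - a \<le> 2 * a" using \<open>0 < a\<close> by (simp add: dvd_imp_le)
  then have le: "a * a + 2 \<le> 3 * a" by (simp add: power2_eq_square)
  have "a < 3"
  proof (rule ccontr)
    assume "\<not> a < 3"
    then have "3 * a \<le> a * a" by simp
    then show False using le by linarith
  qed
  then show ?thesis using \<open>0 < a\<close> by auto
qed

context ones_code
begin

text \<open>The first four moments force \<open>n = a\<^sup>2 + 2\<close> and
  \<open>|F| = n\<^sup>2 - n + 2 = (a\<^sup>2 - a + 2)(a\<^sup>2 + a + 2)\<close> for \<open>a = v - u\<close>,
  and both factors are powers of two.\<close>

lemma card_V_of_two_weights: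
  assumes str: "strength 4" and inner: "inner = {u, v}" and uv: "u < v" "u + v = card V"
    and n: "4 < card V"
  shows "card V = 6"
proof -
  define a where "a = v - u"
  define N where "N = real (card F)"
  define r where "r = real (card V)"
  define x where "x = real a"
  define A where "A = real (card {c\<in>F. card c = u \<or> card c = v})"
  \<comment> \<open>The two weights lie symmetrically about \<open>r / 2\<close>, so even powers of
    \<open>r - 2 * real (card c)\<close> do not tell them apart.\<close>
  have ru: "r - 2 * real u = x" "r - 2 * real v = - x" using uv by (auto simp: r_def x_def a_def)
  have split: "(\<Sum>c\<in>F. (r - 2 * real (card c)) ^ (2 * m)) = 2 * r ^ (2 * m) + A * x ^ (2 * m)" for m
  proof -
    let ?G = "{c\<in>F. card c = u \<or> card c = v}"
    have "u \<in> inner" "v \<in> inner" using inner by auto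
    then have notin: "{} \<notin> ?G" "V \<notin> ?G" "{} \<noteq> V" by (auto simp: inner_def)
    have "F = insert {} (insert V ?G)"
      using card_inner_mem inner empty_mem V_mem by blast
    then have "(\<Sum>c\<in>F. (r - 2 * real (card c)) ^ (2 * m))
        = (\<Sum>c\<in>insert {} (insert V ?G). (r - 2 * real (card c)) ^ (2 * m))" by simp
    also have "\<dots> = r ^ (2 * m) + (r - 2 * r) ^ (2 * m) + (\<Sum>c\<in>?G. (r - 2 * real (card c)) ^ (2 * m))"
      using notin finF by (simp add: r_def)
    also have "(\<Sum>c\<in>?G. (r - 2 * real (card c)) ^ (2 * m)) = (\<Sum>c\<in>?G. x ^ (2 * m))"
    proof (rule sum.cong)
      fix c assume "c \<in> ?G"
      then have "r - 2 * real (card c) = x \<or> r - 2 * real (card c) = - x" using ru by auto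
      then show "(r - 2 * real (card c)) ^ (2 * m) = x ^ (2 * m)" by (elim disjE) simp_all
    qed simp
    also have "(r - 2 * r) ^ (2 * m) = r ^ (2 * m)" by simp
    finally show ?thesis by (simp add: A_def)
  qed
  have E0: "N = 2 + A" using split[of 0] by (simp add: N_def)
  have E2: "2 * r ^ 2 + A * x ^ 2 = N * r"
    using split[of 1] power_moments(1)[OF str] by (simp add: r_def N_def)
  have E4: "2 * r ^ 4 + A * x ^ 4 = N * (3 * r ^ 2 - 2 * r)"
    using split[of 2] power_moments(2)[OF str] by (simp add: r_def N_def)
  have "0 < N" "4 < r" using card_F_pos n by (auto simp: N_def r_def)
  have F2: "N * (r - x ^ 2) = 2 * (r ^ 2 - x ^ 2)" using E0 E2 by algebra
  have "N * (3 * r ^ 2 - 2 * r - x ^ 4) = 2 * (r ^ 2 - x ^ 2) * (r ^ 2 + x ^ 2)"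
    using E0 E4 by algebra
  then have "N * (3 * r ^ 2 - 2 * r - x ^ 4) = N * ((r - x ^ 2) * (r ^ 2 + x ^ 2))"
    using F2 by algebra
  then have "3 * r ^ 2 - 2 * r - x ^ 4 = (r - x ^ 2) * (r ^ 2 + x ^ 2)"
    using \<open>0 < N\<close> by simp
  \<comment> \<open>With \<open>A\<close> and \<open>N\<close> eliminated the moment equations
    factor; \<open>4 < r\<close> excludes the roots 0 and 1.\<close>
  then have "r * (r - 1) * (x ^ 2 + 2 - r) = 0" by algebra
  then have rx: "r = x ^ 2 + 2" using \<open>4 < r\<close> by simp
  then have "N * 2 = 2 * (r ^ 2 - x ^ 2)" using F2 by simp
  then have "N = (x ^ 2 + 2 - x) * (x ^ 2 + x + 2)" using rx by algebra
  moreover have "a \<le> a ^ 2" by (cases a) (auto simp: power2_eq_square)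
  then have "real (a ^ 2 + 2 - a) = x ^ 2 + 2 - x" by (simp add: x_def of_nat_diff)
  moreover have "real (a ^ 2 + a + 2) = x ^ 2 + x + 2" by (simp add: x_def)
  ultimately have "real (card F) = real ((a ^ 2 + 2 - a) * (a ^ 2 + a + 2))"
    by (simp only: N_def of_nat_mult)
  then have "card F = (a ^ 2 + 2 - a) * (a ^ 2 + a + 2)" by (simp only: of_nat_eq_iff)
  moreover have "card F dvd 2 ^ card V" using card_mult_card_dual by (metis dvd_triv_left)
  ultimately have "a = 1 \<or> a = 2"
    using small_of_power_of_two_factors[of a "card V"] uv by (simp add: a_def)
  moreover have "real (card V) = real (a ^ 2 + 2)" using rx by (simp add: r_def x_def)
  then have "card V = a ^ 2 + 2" by (simp only: of_nat_eq_iff)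
  \<comment> \<open>The value \<open>a = 1\<close> would give length 3.\<close>
  ultimately show ?thesis using n by auto
qed

end

subsection \<open>Designs in the dual of a code with a single inner weight\<close>

lemma coeff_one_minus_X2_power:
  assumes "j \<le> m"
  shows "coeff ((1 - monom 1 2) ^ m :: int poly) (2 * j) = (-1) ^ j * int (m choose j)"
proof -
  have "(1 - monom 1 2 :: int poly) ^ m = (monom (- 1) 2 + 1) ^ m"
    by (simp add: minus_monom[symmetric])
  also have "\<dots> = (\<Sum>k\<le>m. monom (int (m choose k) * (-1) ^ k) (2 * k))"
    by (simp add: binomial_ring monom_power of_nat_monom mult_monom mult.commute)
  also have "coeff \<dots> (2 * j) = (\<Sum>k\<le>m. if k = j then int (m choose k) * (-1) ^ k else 0)"
    by (simp add: coeff_sum)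
  finally show ?thesis using assms by simp
qed

lemma one_minus_X2_nonzero: "(1 - monom 1 2 :: int poly) \<noteq> 0"
proof
  assume "(1 - monom 1 2 :: int poly) = 0"
  then have "coeff (1 - monom 1 2 :: int poly) 0 = 0" by (simp only: coeff_0)
  then show False by simp
qed

context set_code
begin

text \<open>The weight enumerator of the dual words through \<open>T\<close>, with weights counted
  outside \<open>T\<close>, so that points of \<open>T\<close> contribute the factor 1.\<close>

definition through :: "'a set \<Rightarrow> int poly"
  where "through T = (\<Sum>y | y \<in> dual \<and> T \<subseteq> y. monom 1 (card y - card T))"

lemma coeff_through:
  assumes "finite T" "card T \<le> w"
  shows "coeff (through T) (w - card T) = int (card {y\<in>dual. card y = w \<and> T \<subseteq> y})"
proof -
  have "coeff (through T) (w - card T)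
      = (\<Sum>y | y \<in> dual \<and> T \<subseteq> y. if card y - card T = w - card T then 1 else 0)"
    by (simp add: through_def coeff_sum)
  also have "\<dots> = (\<Sum>y | y \<in> dual \<and> T \<subseteq> y. if card y = w then 1 else 0)"
  proof (intro sum.cong if_cong refl)
    fix y assume "y \<in> {y. y \<in> dual \<and> T \<subseteq> y}"
    then have "card T \<le> card y"
      using dual_subset finV by (metis (mono_tags, lifting) card_mono finite_subset mem_Collect_eq)
    then show "(card y - card T = w - card T) = (card y = w)" using assms by auto
  qed
  also have "\<dots> = int (card {y\<in>dual. card y = w \<and> T \<subseteq> y})"
    using finite_dual by (auto simp: sum.If_cases intro!: arg_cong[where f = card])
  finally show ?thesis .
qed

lemma Pow_Int_dual:
  assumes str: "strength k" and T: "T \<subseteq> V" "card T \<le> k + 1"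
  shows "Pow T \<inter> dual = (if T \<in> dual then {{}, T} else {{}})"
proof -
  have fT: "finite T" using T finV finite_subset by blast
  have "y = {} \<or> y = T" if y: "y \<in> dual" "y \<subseteq> T" for y
  proof (rule ccontr)
    assume "\<not> (y = {} \<or> y = T)"
    then have "k < card y" "card y < card T"
      using str y fT by (auto simp: strength_def intro: psubset_card_mono)
    then show False using T by simp
  qed
  then show ?thesis using empty_mem_dual by auto
qed

lemma sum_prod_chi_minus:
  assumes str: "strength k" and T: "T \<subseteq> V" "T \<noteq> {}" "card T \<le> k + 1"
  shows "(\<Sum>c\<in>F. \<Prod>i\<in>T. chi i c - X)
    = of_nat (card F) * ((- X) ^ card T + of_bool (T \<in> dual) :: 'b::{idom,ring_char_0})"
proof -
  have fT: "finite T" using T finV finite_subset by blast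
  have "(\<Sum>c\<in>F. \<Prod>i\<in>T. chi i c - X) = (\<Sum>c\<in>F. \<Prod>i\<in>T. 1 * chi i c + (- X))"
    by simp
  also have "\<dots> = of_nat (card F) * (\<Sum>Y\<in>Pow T \<inter> dual. (\<Prod>i\<in>Y. 1) * (\<Prod>i\<in>T - Y. - X))"
    by (rule sum_prod_chi[OF T(1)])
  also have "\<dots> = of_nat (card F) * ((- X) ^ card T + of_bool (T \<in> dual))"
    using Pow_Int_dual[OF str T(1,3)] T(2) by (auto simp: add.commute)
  finally show ?thesis .
qed

text \<open>Poisson summation with \<open>a = 0\<close>, \<open>b = 1\<close> on \<open>T\<close>
  and \<open>a = 1\<close>, \<open>b = X\<close> off it. The prefactor completes the product to all
  of \<open>V\<close>: since \<open>chi\<close> squares to 1,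
  \<open>(chi i c - X) * (1 + X * chi i c)\<close> is \<open>(1 - X * X) * chi i c\<close>.\<close>

lemma through_eq_sum:
  assumes T: "T \<subseteq> V"
  shows "(1 - monom 1 2) ^ card T * (of_nat (card F) * through T)
    = (\<Sum>c\<in>F. (\<Prod>i\<in>T. chi i c - monom 1 1) * (\<Prod>i\<in>V. 1 + monom 1 1 * chi i c))"
proof -
  define X :: "int poly" where "X = monom 1 1"
  have X2: "X * X = monom 1 2" by (simp add: X_def mult_monom numeral_2_eq_2)
  have fT: "finite T" using T finV finite_subset by blast
  define a b :: "'a \<Rightarrow> int poly"
    where "a i = (if i \<in> T then 0 else 1)" and "b i = (if i \<in> T then 1 else X)" for i
  have "(\<Prod>i\<in>y. b i) * (\<Prod>i\<in>V - y. a i) = (if T \<subseteq> y then monom 1 (card y - card T) else 0)"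
    if y: "y \<in> dual" for y
  proof (cases "T \<subseteq> y")
    case True
    have fy: "finite y" using dual_subset[OF y] finV finite_subset by blast
    have "(\<Prod>i\<in>y. b i) = (\<Prod>i\<in>y - T. b i)"
      by (rule prod.mono_neutral_right) (use fy in \<open>auto simp: b_def\<close>)
    also have "\<dots> = X ^ card (y - T)" by (simp add: b_def)
    also have "\<dots> = monom 1 (card y - card T)"
      using True fT by (simp add: X_def monom_power card_Diff_subset)
    moreover have "(\<Prod>i\<in>V - y. a i) = 1"
      by (rule prod.neutral) (use True in \<open>auto simp: a_def\<close>)
    ultimately show ?thesis using True by simp
  next
    case False
    then obtain i where "i \<in> T" "i \<notin> y" by blast
    then have "(\<Prod>i\<in>V - y. a i) = 0"
      using T finV by (intro prod_zero) (auto simp: a_def)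
    then show ?thesis using False by simp
  qed
  moreover have "Pow V \<inter> dual = dual" using dual_subset by blast
  ultimately have "of_nat (card F) * through T = (\<Sum>c\<in>F. \<Prod>i\<in>V. b i * chi i c + a i)"
    using finite_dual by (subst sum_prod_chi[OF order_refl]) (simp add: through_def sum.If_cases Int_def)
  moreover have "(1 - X * X) ^ card T * (\<Prod>i\<in>V. b i * chi i c + a i)
      = (\<Prod>i\<in>T. chi i c - X) * (\<Prod>i\<in>V. 1 + X * chi i c)" for c
  proof -
    have split: "(\<Prod>i\<in>V. g i) = (\<Prod>i\<in>T. g i) * (\<Prod>i\<in>V - T. g i)" for g :: "'a \<Rightarrow> int poly"
      using prod.subset_diff[OF T finV, of g] by (simp add: mult.commute)
    have "(1 - X * X) ^ card T * (\<Prod>i\<in>T. b i * chi i c + a i) = (\<Prod>i\<in>T. (1 - X * X) * chi i c)"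
      by (simp add: prod.distrib a_def b_def)
    also have "\<dots> = (\<Prod>i\<in>T. (chi i c - X) * (1 + X * chi i c))"
      by (rule prod.cong) (auto simp: chi_def algebra_simps)
    moreover have "(\<Prod>i\<in>V - T. b i * chi i c + a i) = (\<Prod>i\<in>V - T. 1 + X * chi i c)"
      by (rule prod.cong) (auto simp: a_def b_def)
    ultimately show ?thesis
      by (simp only: split prod.distrib mult.assoc[symmetric])
  qed
  ultimately show ?thesis
    unfolding X2[symmetric] X_def[symmetric] by (simp add: sum_distrib_left)
qed

end

context ones_code
begin

text \<open>All words but the zero word and the all-one word contribute the same factor
  \<open>(1 - X\<^sup>2)\<^sup>h\<close>.\<close>

lemma through_diff:
  assumes str: "strength k" and h: "card V = 2 * h" "inner = {h}"
    and T: "T \<subseteq> V" "T' \<subseteq> V" "card T = \<tau>" "card T' = \<tau>" "0 < \<tau>" "\<tau> \<le> k + 1"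
  shows "(1 - monom 1 2) ^ \<tau> * (through T - through T')
    = (1 - monom 1 2) ^ h * (of_bool (T \<in> dual) - of_bool (T' \<in> dual))"
proof -
  define X :: "int poly" where "X = monom 1 1"
  have X2: "X * X = monom 1 2" by (simp add: X_def mult_monom numeral_2_eq_2)
  define R :: "'a set \<Rightarrow> int poly" where "R c = (\<Prod>i\<in>V. 1 + X * chi i c)" for c
  have R: "R c = (1 - X) ^ card c * (1 + X) ^ (card V - card c)" if "c \<in> F" for c
  proof -
    have "R c = (\<Prod>i\<in>c. 1 + X * chi i c) * (\<Prod>i\<in>V - c. 1 + X * chi i c)"
      unfolding R_def using prod.subset_diff[OF subV[OF that] finV, of "\<lambda>i. 1 + X * chi i c"]
      by (simp add: mult.commute)
    then show ?thesis using that by (simp add: chi_def card_compl)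
  qed
  \<comment> \<open>All contributions that depend on \<open>T\<close> only through its size; they
    cancel in the difference.\<close>
  define E where "E = of_nat (card F) * ((1 - X * X) ^ h * (- X) ^ \<tau>)
    + (1 - X) ^ \<tau> * (R {} - (1 - X * X) ^ h) + (- 1 - X) ^ \<tau> * (R V - (1 - X * X) ^ h)"
  have main: "(1 - X * X) ^ \<tau> * (of_nat (card F) * through T)
      = E + of_nat (card F) * ((1 - X * X) ^ h * of_bool (T \<in> dual))"
    if T: "T \<subseteq> V" "card T = \<tau>" for T
  proof -
    have "finite T" "T \<noteq> {}" using T finV finite_subset \<open>0 < \<tau>\<close> by auto
    define G where "G c = (\<Prod>i\<in>T. chi i c - X)" for c
    have G: "G {} = (1 - X) ^ \<tau>" "G V = (- 1 - X) ^ \<tau>"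
      using T by (auto simp: G_def chi_def subset_iff)
    have ne: "{} \<noteq> V" using \<open>T \<noteq> {}\<close> T by auto
    have "(1 - X * X) ^ \<tau> * (of_nat (card F) * through T) = (\<Sum>c\<in>F. G c * R c)"
      using through_eq_sum[OF T(1), folded X2 X_def] T by (simp add: G_def R_def)
    \<comment> \<open>Splitting off the value of \<open>R\<close> at weight \<open>h\<close> leaves
      corrections at \<open>{}\<close> and \<open>V\<close> only.\<close>
    also have "\<dots> = (\<Sum>c\<in>F. G c * (1 - X * X) ^ h) + (\<Sum>c\<in>F. G c * (R c - (1 - X * X) ^ h))"
      by (simp add: algebra_simps flip: sum.distrib)
    also have "(\<Sum>c\<in>F. G c * (R c - (1 - X * X) ^ h)) = (\<Sum>c\<in>{{}, V}. G c * (R c - (1 - X * X) ^ h))"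
    proof (rule sum.mono_neutral_right)
      show "\<forall>c\<in>F - {{}, V}. G c * (R c - (1 - X * X) ^ h) = 0"
      proof
        fix c assume c: "c \<in> F - {{}, V}"
        then have "card c = h" using card_inner_mem h by blast
        then have "R c = ((1 - X) * (1 + X)) ^ h" using R[of c] c h by (simp add: power_mult_distrib)
        also have "(1 - X) * (1 + X) = 1 - X * X" by (simp add: algebra_simps)
        finally show "G c * (R c - (1 - X * X) ^ h) = 0" by simp
      qed
    qed (use finF empty_mem V_mem in auto)
    also have "(\<Sum>c\<in>F. G c * (1 - X * X) ^ h)
        = of_nat (card F) * ((- X) ^ \<tau> + of_bool (T \<in> dual)) * (1 - X * X) ^ h"
      using sum_prod_chi_minus[OF str, of T X] T \<open>T \<noteq> {}\<close> \<open>\<tau> \<le> k + 1\<close>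
      by (simp add: G_def flip: sum_distrib_right)
    finally show ?thesis using ne by (simp add: E_def G algebra_simps)
  qed
  have "of_nat (card F) * ((1 - X * X) ^ \<tau> * (through T - through T'))
      = of_nat (card F) * ((1 - X * X) ^ h * (of_bool (T \<in> dual) - of_bool (T' \<in> dual)))"
    using main[of T] main[of T'] T by (simp add: algebra_simps)
  then show ?thesis using card_F_pos by (simp add: X2)
qed

text \<open>A set of at most \<open>k\<close> points is too small to be a nonzero dual word, so the
  right side of \<open>through_diff\<close> vanishes.\<close>

lemma dual_design:
  assumes str: "strength k" and h: "card V = 2 * h" "inner = {h}"
    and T: "T \<subseteq> V" "T' \<subseteq> V" "card T = \<tau>" "card T' = \<tau>" "0 < \<tau>" "\<tau> \<le> k" "\<tau> \<le> w"
  shows "card {y\<in>dual. card y = w \<and> T \<subseteq> y} = card {y\<in>dual. card y = w \<and> T' \<subseteq> y}"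
proof -
  have fin: "finite T" "finite T'" using T finV finite_subset by blast+
  have nd: "X \<notin> dual" if "card X = \<tau>" for X
    using that str T by (auto simp: strength_def)
  have "through T = through T'"
    using through_diff[OF str h T(1-5)] T nd one_minus_X2_nonzero by simp
  then show ?thesis using coeff_through[of T w] coeff_through[of T' w] fin T by simp
qed

text \<open>The enumerators differ by \<open>(1 - X^2)^(h - \<tau>)\<close>, whose coefficients at
  even exponents up to \<open>2 * (h - \<tau>)\<close> are signed binomials; the bounds on
  \<open>w\<close> put \<open>w - \<tau>\<close> among these exponents.\<close>

lemma dual_not_design:
  assumes str: "strength k" and h: "card V = 2 * h" "inner = {h}"
    and T: "T \<in> dual" "T' \<subseteq> V" "T' \<notin> dual" "card T = \<tau>" "card T' = \<tau>" "0 < \<tau>" "\<tau> \<le> k + 1"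
    and w: "\<tau> \<le> h" "\<tau> \<le> w" "w \<le> card V - \<tau>" "even w"
  shows "card {y\<in>dual. card y = w \<and> T \<subseteq> y} \<noteq> card {y\<in>dual. card y = w \<and> T' \<subseteq> y}"
proof -
  have fin: "finite T" "finite T'" using T dual_subset[of T] finV finite_subset by blast+
  note ne = one_minus_X2_nonzero
  have "(1 - monom 1 2) ^ \<tau> * (through T - through T') = (1 - monom 1 2) ^ h"
    using through_diff[OF str h dual_subset[OF T(1)] T(2,4-7)] T by simp
  also have "\<dots> = (1 - monom 1 2) ^ \<tau> * (1 - monom 1 2) ^ (h - \<tau>)"
    using w by (simp flip: power_add)
  finally have "through T - through T' = (1 - monom 1 2) ^ (h - \<tau>)"
    using ne by simp
  moreover have "even (w - \<tau>)" using w(4) even_card_dual[OF T(1)] T(4) by simp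
  then obtain j where j: "w - \<tau> = 2 * j" by (rule evenE)
  moreover have jh: "j \<le> h - \<tau>" using j w h by linarith
  ultimately have "coeff (through T) (w - \<tau>) - coeff (through T') (w - \<tau>)
      = (-1) ^ j * int ((h - \<tau>) choose j)"
    using coeff_one_minus_X2_power[of j "h - \<tau>"] jh j by (simp flip: coeff_diff)
  moreover have "0 < ((h - \<tau>) choose j)" using jh by (rule zero_less_binomial)
  ultimately show ?thesis
    using coeff_through[of T w] coeff_through[of T' w] fin T w by auto
qed

text \<open>A dual word \<open>T\<close> has even size, so in \<open>card_pattern\<close> it
  contributes a second 1. The \<open>Suc\<close> accounts for the all-one word, which also contains
  \<open>T\<close>.\<close>

lemma card_through_word:
  assumes str: "strength k" and h: "inner = {h}"
    and T: "T \<subseteq> V" "T \<noteq> {}" "card T \<le> k + 1"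
  shows "int (Suc (card {c\<in>F. card c = h \<and> T \<subseteq> c})) * 2 ^ card T
    = int (card F) * (1 + of_bool (T \<in> dual))"
proof -
  have "Pow T \<inter> dual = (if T \<in> dual then {{}, T} else {{}})"
    by (rule Pow_Int_dual[OF str T(1,3)])
  then have "int (card {c\<in>F. T \<subseteq> c}) * 2 ^ card T = int (card F) * (1 + of_bool (T \<in> dual))"
    using card_pattern[of "{}" T] T even_card_dual[of T] by auto
  moreover have "{c\<in>F. T \<subseteq> c} = insert V {c\<in>F. card c = h \<and> T \<subseteq> c}"
    using T V_mem card_inner_mem h by blast
  moreover have "h < card V" using h by (auto simp: inner_def)
  ultimately show ?thesis using finF by simp
qed

lemma inner_singleton_half:
  assumes "inner = {h}"
  shows "card V = 2 * h"
proof -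
  have "h \<in> inner" using assms by simp
  then have "card V - h \<in> {h}" "h < card V" using inner_compl assms by (blast, simp add: inner_def)
  then show ?thesis by simp
qed

text \<open>Patterns on three points give words \<open>x\<close> and \<open>z\<close> such that both
  and their sum are neither zero nor \<open>V\<close>. All three have weight \<open>h\<close>, and a
  sum of two words of equal weight has even weight.\<close>

lemma even_single_weight:
  assumes str: "strength k" and h: "inner = {h}" and "3 \<le> k" "k < card V"
  shows "even h"
proof -
  have "3 \<le> card V" using assms by simp
  then obtain T where T: "T \<subseteq> V" "card T = 3" "finite T" by (rule obtain_subset_with_card_n)
  then obtain i j l where ijl: "T = {i, j, l}" "i \<noteq> j" "i \<noteq> l" "j \<noteq> l"
    by (auto simp: card_3_iff)
  obtain x where x: "x \<in> F" "x \<inter> {l} = {}" "{i, j} \<subseteq> x"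
    using ex_pattern[OF str, of "{l}" "{i, j}"] T ijl assms by auto
  obtain z where z: "z \<in> F" "z \<inter> {j} = {}" "{i, l} \<subseteq> z"
    using ex_pattern[OF str, of "{j}" "{i, l}"] T ijl assms by auto
  have xz: "sym_diff x z \<in> F" using x z by (simp add: sym_diff_mem)
  have "card x = h"
    using card_inner_mem[OF x(1)] x ijl T h by blast
  moreover have "card z = h"
    using card_inner_mem[OF z(1)] z ijl T h by blast
  moreover have "card (sym_diff x z) = h"
    using card_inner_mem[OF xz] x z ijl T h by blast
  ultimately show ?thesis
    using even_card_sym_diff[of x z] finite_word x z by simp
qed

text \<open>If \<open>k = h\<close>, then \<open>k \<ge> 3\<close> contradicts the parity of
  \<open>h\<close>, and \<open>k = 1\<close> gives length 2 with \<open>V\<close> dual to a word of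
  weight 1.\<close>

lemma single_weight_ge:
  assumes str: "strength k" and h: "inner = {h}" and "odd k" "k \<le> h"
    and y: "y \<in> dual" "card y = k + 1"
  shows "k + 1 \<le> h"
proof (rule ccontr)
  assume "\<not> k + 1 \<le> h"
  then have kh: "k = h" using \<open>k \<le> h\<close> by simp
  have "card y \<le> card V" by (rule card_mono[OF finV dual_subset[OF y(1)]])
  then have "\<not> 3 \<le> k" using even_single_weight[OF str h] y \<open>odd k\<close> kh by auto
  moreover have "k \<noteq> 2" using \<open>odd k\<close> by auto
  moreover have "k \<noteq> 0" using \<open>odd k\<close> by (auto intro: Nat.gr0I)
  ultimately have "h = 1" using kh by linarith
  then have "card y = card V" using inner_singleton_half[OF h] y kh by simp
  then have "y = V" using dual_subset[OF y(1)] finV by (simp add: card_subset_eq)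
  moreover obtain c where c: "c \<in> F" "card c = 1" using h \<open>h = 1\<close> by (auto simp: inner_def)
  ultimately show False using dual_even[OF y(1) c(1)] subV[OF c(1)] by (simp add: Int_absorb2)
qed

text \<open>For \<open>k \<ge> 3\<close> all weights of \<open>F\<close> are even, so
  \<open>V\<close> is a dual word and complementation maps \<open>y\<close> to a dual word of weight
  above \<open>k\<close>. For \<open>k = 1\<close> the parity of \<open>card y\<close> and
  \<open>card V\<close> suffices.\<close>

lemma dual_weight_le:
  assumes str: "strength k" and h: "inner = {h}" and "odd k"
    and y: "y \<in> dual" "card y < card V" "y \<noteq> {}"
  shows "card y \<le> card V - (k + 1)"
proof (cases "3 \<le> k")
  case True
  have "k < card V" using str y by (auto simp: strength_def)
  have "even (card (c \<inter> V))" if c: "c \<in> F" for c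
  proof -
    have "c = {} \<or> c = V \<or> card c = h" using card_inner_mem[OF c] h by auto
    moreover have "c \<inter> V = c" using subV[OF c] by blast
    ultimately show ?thesis
      using even_single_weight[OF str h True \<open>k < card V\<close>] inner_singleton_half[OF h] by auto
  qed
  then have "V \<in> dual" by (simp add: dual_def)
  then have "sym_diff V y \<in> dual" using y dual_sym_diff by blast
  also have "sym_diff V y = V - y" using dual_subset[OF y(1)] by blast
  finally have "V - y \<in> dual" .
  moreover have "card (V - y) = card V - card y"
    using dual_subset[OF y(1)] finV by (meson card_Diff_subset finite_subset)
  moreover have "V - y \<noteq> {}" using y dual_subset[OF y(1)] by auto
  ultimately have "k < card V - card y" using str by (auto simp: strength_def)
  then show ?thesis by simp
next
  case False
  moreover have "k \<noteq> 2" "k \<noteq> 0" using \<open>odd k\<close> by (auto intro: Nat.gr0I)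
  ultimately have "k = 1" by linarith
  have "even (card y)" "even (card V)" using even_card_dual[OF y(1)] inner_singleton_half[OF h] by auto
  then have "card y \<noteq> card V - 1" using y by (auto elim!: evenE)
  then show ?thesis using y \<open>k = 1\<close> by simp
qed

text \<open>One point of a word of weight \<open>h\<close> and \<open>k\<close> points of its
  complement, also of size \<open>h\<close>, form a set meeting that word once.\<close>

lemma ex_non_dual:
  assumes h: "inner = {h}" and "k \<le> h"
  obtains T where "T \<subseteq> V" "card T = k + 1" "T \<notin> dual"
proof -
  obtain c where c: "c \<in> F" "card c = h" and "0 < h" using h by (auto simp: inner_def)
  then obtain i where i: "i \<in> c" by fastforce
  have "k \<le> card (V - c)" using card_compl[OF c(1)] c inner_singleton_half[OF h] assms by simp
  then obtain X where X: "X \<subseteq> V - c" "card X = k" "finite X" by (rule obtain_subset_with_card_n)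
  have "c \<inter> insert i X = {i}" using X i by blast
  then have "odd (card (c \<inter> insert i X))" by simp
  then have "insert i X \<notin> dual" using dual_even[of _ c] c by blast
  moreover have "insert i X \<subseteq> V" using X i subV[OF c(1)] by blast
  moreover have "i \<notin> X" using X i by blast
  ultimately show ?thesis using that[of "insert i X"] X by simp
qed

end

subsection \<open>Support designs\<close>

text \<open>Counting pairs of a block through \<open>T\<close> and a further point in it gives the
  classical quotient for the smaller parameter. A maximal parameter can thus be found by testing two
  consecutive values.\<close>

lemma is_t_design_antimono:
  assumes "is_t_design v k B t" "s \<le> t"
  shows "is_t_design v k B s"
  using assms(2)
proof (induction s rule: inc_induct)
  case base
  then show ?case using assms(1) .
next
  case (step s)
  then obtain lam where lam: "\<And>T. T \<subseteq> {..<v} \<Longrightarrow> card T = Suc s \<Longrightarrow> card {b\<in>B. T \<subseteq> b} = lam"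
    and B: "\<And>b. b \<in> B \<Longrightarrow> b \<subseteq> {..<v}" "\<And>b. b \<in> B \<Longrightarrow> card b = k" and "Suc s \<le> k"
    by (auto simp: is_t_design_def)
  have finB: "finite B" using B(1) by (meson PowI finite_Pow_iff finite_lessThan finite_subset subsetI)
  have "card {b\<in>B. T \<subseteq> b} = (v - s) * lam div (k - s)" if T: "T \<subseteq> {..<v}" "card T = s" for T
  proof -
    have fT: "finite T" using T(1) finite_subset by blast
    let ?G = "{b\<in>B. T \<subseteq> b}"
    have "(v - s) * lam = (\<Sum>x\<in>{..<v} - T. lam)"
      using T fT by (simp add: card_Diff_subset)
    also have "\<dots> = (\<Sum>x\<in>{..<v} - T. card {b\<in>B. insert x T \<subseteq> b})"
      using T fT by (intro sum.cong lam[symmetric]) auto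
    also have "\<dots> = (\<Sum>x\<in>{..<v} - T. \<Sum>b\<in>?G. if x \<in> b then 1 else 0)"
      using finB by (intro sum.cong) (auto simp: sum.If_cases intro!: arg_cong[where f = card])
    also have "\<dots> = (\<Sum>b\<in>?G. \<Sum>x\<in>{..<v} - T. if x \<in> b then 1 else 0)" by (rule sum.swap)
    also have "\<dots> = (\<Sum>b\<in>?G. k - s)"
    proof (rule sum.cong)
      fix b assume b: "b \<in> ?G"
      have "({..<v} - T) \<inter> {x. x \<in> b} = b - T" using B(1)[of b] b by blast
      then show "(\<Sum>x\<in>{..<v} - T. if x \<in> b then 1 else 0) = k - s"
        using b B(2)[of b] T fT by (simp add: sum.If_cases card_Diff_subset)
    qed simp
    finally have "(v - s) * lam = card ?G * (k - s)" by simp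
    then show ?thesis using \<open>Suc s \<le> k\<close> by simp
  qed
  then show ?case using B \<open>Suc s \<le> k\<close> by (auto simp: is_t_design_def)
qed

lemma is_t_design_weightD:
  assumes "is_t_design v k {x\<in>X. card x = w} t"
  shows "\<exists>lam. \<forall>T. T \<subseteq> {..<v} \<and> card T = t \<longrightarrow> card {x\<in>X. card x = w \<and> T \<subseteq> x} = lam"
proof -
  have eq: "{b \<in> {x\<in>X. card x = w}. T \<subseteq> b} = {x\<in>X. card x = w \<and> T \<subseteq> x}" for T by blast
  show ?thesis using assms unfolding is_t_design_def eq by (elim conjE)
qed

lemma Greatest_antimono:
  fixes P :: "nat \<Rightarrow> bool"
  assumes "P t" "\<not> P (Suc t)" "\<And>r s. P r \<Longrightarrow> s \<le> r \<Longrightarrow> P s"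
  shows "(GREATEST t. P t) = t"
proof (rule Greatest_equality)
  show "s \<le> t" if "P s" for s
    using assms(2,3) that not_less_eq_eq by blast
qed (rule assms(1))

text \<open>When all inner weights have the same maximal strength, both maxima equal it;
  nonemptiness keeps the condition in \<open>delta_code\<close> from holding vacuously.\<close>

lemma delta_s_code_eqI:
  assumes "inner_weights n C \<noteq> {}"
    and "\<And>w. w \<in> inner_weights n C \<Longrightarrow> is_t_design n w (support_design n C w) k"
    and "\<And>w. w \<in> inner_weights n C \<Longrightarrow> \<not> is_t_design n w (support_design n C w) (Suc k)"
  shows "delta_code n C = k" "s_code n C = k"
proof -
  obtain w where w: "w \<in> inner_weights n C" using assms(1) by blast
  show "delta_code n C = k"
    unfolding delta_code_def
  proof (rule Greatest_antimono)
    show "\<not> (\<forall>w\<in>inner_weights n C. is_t_design n w (support_design n C w) (Suc k))"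
      using w assms(3) by blast
  qed (use assms(2) is_t_design_antimono in auto)
  show "s_code n C = k"
    unfolding s_code_def
  proof (rule Greatest_antimono)
    show "\<exists>w\<in>inner_weights n C. is_t_design n w (support_design n C w) k"
      using w assms(2) by blast
    show "\<exists>w\<in>inner_weights n C. is_t_design n w (support_design n C w) s"
      if "\<exists>w\<in>inner_weights n C. is_t_design n w (support_design n C w) r" "s \<le> r" for r s
      using that is_t_design_antimono by blast
  qed (use assms(3) in blast)
qed

section \<open>From bit vectors to supports\<close>

lemma supp_vadd: "supp n (vadd x y) = sym_diff (supp n x) (supp n y)"
proof -
  have "x i + y i \<noteq> 0 \<longleftrightarrow> (x i \<noteq> 0 \<longleftrightarrow> y i = 0)" for i
    by (cases "x i"; cases "y i") simp_all
  then show ?thesis by (auto simp: supp_def vadd_def)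
qed

lemma supp_eq_empty_iff:
  assumes "x \<in> vecs n"
  shows "supp n x = {} \<longleftrightarrow> x = zero_vec"
proof
  assume x: "supp n x = {}"
  have "x i = 0" for i
    by (cases "i < n") (use assms x in \<open>auto simp: supp_def vecs_def\<close>)
  then show "x = zero_vec" by (simp add: zero_vec_def fun_eq_iff)
qed (simp add: supp_def zero_vec_def)

lemma of_nat_bit_eq_0_iff: "(of_nat k :: bit) = 0 \<longleftrightarrow> even k"
  by (cases "even k") (auto elim!: evenE oddE)

lemma inner_product_eq_0_iff:
  "(\<Sum>i<n. x i * y i :: bit) = 0 \<longleftrightarrow> even (card (supp n x \<inter> supp n y))"
proof -
  have "(\<Sum>i<n. x i * y i) = (\<Sum>i<n. if i \<in> supp n x \<inter> supp n y then 1 else 0)"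
    by (rule sum.cong) (auto simp: supp_def)
  also have "\<dots> = of_nat (card ({..<n} \<inter> (supp n x \<inter> supp n y)))"
    by (simp add: sum.If_cases Int_def)
  also have "{..<n} \<inter> (supp n x \<inter> supp n y) = supp n x \<inter> supp n y"
    by (auto simp: supp_def)
  finally show ?thesis by (simp add: of_nat_bit_eq_0_iff)
qed

lemma supp_indicator:
  assumes "S \<subseteq> {..<n}"
  shows "supp n (\<lambda>i. if i \<in> S then 1 else 0) = S" "(\<lambda>i. if i \<in> S then 1 else 0) \<in> vecs n"
  using assms by (auto simp: supp_def vecs_def)

lemma mem_dual_code_iff:
  "y \<in> dual_code n C \<longleftrightarrow> y \<in> vecs n \<and> (\<forall>x\<in>C. even (card (supp n x \<inter> supp n y)))"
  by (simp only: dual_code_def inner_product_eq_0_iff mem_Collect_eq)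

lemma set_code_supp:
  assumes "binary_linear_code n C"
  shows "set_code {..<n} (supp n ` C)"
proof
  show "{} \<in> supp n ` C"
    using assms by (force simp: binary_linear_code_def supp_def zero_vec_def)
  show "sym_diff x y \<in> supp n ` C" if "x \<in> supp n ` C" "y \<in> supp n ` C" for x y
    using that assms unfolding binary_linear_code_def by (auto simp: supp_vadd[symmetric])
qed (auto simp: supp_def)

lemma supp_dual_code:
  assumes "binary_linear_code n C"
  shows "supp n ` dual_code n C = set_code.dual {..<n} (supp n ` C)"
proof -
  interpret set_code "{..<n}" "supp n ` C" by (rule set_code_supp[OF assms])
  show ?thesis
  proof
    show "supp n ` dual_code n C \<subseteq> dual"
    proof
      fix S assume "S \<in> supp n ` dual_code n C"
      then obtain y where y: "S = supp n y" "y \<in> dual_code n C" by blast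
      then have "\<forall>x\<in>C. even (card (supp n x \<inter> S))"
        by (simp add: mem_dual_code_iff)
      moreover have "S \<subseteq> {..<n}" using y by (auto simp: supp_def)
      ultimately show "S \<in> dual" by (auto simp: dual_def)
    qed
    show "dual \<subseteq> supp n ` dual_code n C"
    proof
      fix S assume S: "S \<in> dual"
      let ?y = "\<lambda>i. if i \<in> S then 1 else (0 :: bit)"
      have y: "supp n ?y = S" "?y \<in> vecs n" using supp_indicator dual_subset[OF S] by blast+
      have "?y \<in> dual_code n C"
        using y S by (simp add: mem_dual_code_iff dual_def)
      then show "S \<in> supp n ` dual_code n C" using y(1) by (metis imageI)
    qed
  qed
qed

lemma support_design_supp: "support_design n C w = {c \<in> supp n ` C. card c = w}"
  by (auto simp: support_design_def weight_class_def wt_def)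

lemma weight_class_nonempty_iff: "weight_class n C w \<noteq> {} \<longleftrightarrow> (\<exists>c\<in>supp n ` C. card c = w)"
  by (auto simp: weight_class_def wt_def)

lemma min_weight_supp:
  assumes "C \<subseteq> vecs n"
  shows "min_weight n C = Min (card ` (supp n ` C - {{}}))"
proof -
  have "{wt n c |c. c \<in> C \<and> c \<noteq> zero_vec} = card ` (supp n ` C - {{}})"
  proof -
    have "c \<noteq> zero_vec \<longleftrightarrow> supp n c \<noteq> {}" if "c \<in> C" for c
      using supp_eq_empty_iff[of c n] that assms by auto
    then show ?thesis by (auto simp: wt_def)
  qed
  then show ?thesis by (simp add: min_weight_def)
qed

section \<open>Support designs of a code with one inner weight, and of its dual of minimum weight
  \<open>k + 1\<close>\<close>

locale single_weight_code = ones_code "{..<n}" F for n :: nat and F +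
  fixes h k :: nat and y0 :: "nat set"
  assumes str: "strength k" and h: "inner = {h}" and odd_k: "odd k" and k_le: "k \<le> h"
    and y0: "y0 \<in> dual" "card y0 = k + 1"
begin

lemma n_eq: "n = 2 * h"
  using inner_singleton_half[OF h] by simp

lemma Suc_k_le: "k + 1 \<le> h"
  by (rule single_weight_ge[OF str h odd_k k_le y0])

lemma k_pos: "0 < k"
  using odd_k by (auto intro: Nat.gr0I)

text \<open>No \<open>k\<close>-set is a dual word, so \<open>card_through_word\<close> gives one
  count for all. At size \<open>k + 1\<close>, with the all-one word included, the dual word
  \<open>y0\<close> has twice the count of a non-dual set.\<close>

lemma code_design:
  "is_t_design n h {c\<in>F. card c = h} k" "\<not> is_t_design n h {c\<in>F. card c = h} (Suc k)"
proof -
  have count: "int (Suc (card {c\<in>F. card c = h \<and> T \<subseteq> c})) * 2 ^ card T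
      = int (card F) * (1 + of_bool (T \<in> dual))" if "T \<subseteq> {..<n}" "0 < card T" "card T \<le> k + 1" for T
    by (rule card_through_word[OF str h]) (use that in auto)
  have "card {c\<in>F. card c = h \<and> T \<subseteq> c} = card F div 2 ^ k - 1" if T: "T \<subseteq> {..<n}" "card T = k" for T
  proof -
    have "T \<notin> dual" using str T k_pos by (auto simp: strength_def)
    then have "int (Suc (card {c\<in>F. card c = h \<and> T \<subseteq> c})) * 2 ^ k = int (card F)"
      using count[OF T(1)] T k_pos by (simp del: of_nat_Suc)
    then have "int (Suc (card {c\<in>F. card c = h \<and> T \<subseteq> c}) * 2 ^ k) = int (card F)"
      by (simp only: of_nat_mult of_nat_power of_nat_numeral)
    then have "card F = Suc (card {c\<in>F. card c = h \<and> T \<subseteq> c}) * 2 ^ k" by (simp only: of_nat_eq_iff)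
    then show ?thesis by simp
  qed
  then show "is_t_design n h {c\<in>F. card c = h} k"
    using subV k_le unfolding is_t_design_def by (auto intro!: exI[of _ "card F div 2 ^ k - 1"])
  show "\<not> is_t_design n h {c\<in>F. card c = h} (Suc k)"
  proof
    assume "is_t_design n h {c\<in>F. card c = h} (Suc k)"
    from is_t_design_weightD[OF this] obtain lam where
      "\<forall>T. T \<subseteq> {..<n} \<and> card T = Suc k \<longrightarrow> card {c\<in>F. card c = h \<and> T \<subseteq> c} = lam" ..
    then have lam: "card {c\<in>F. card c = h \<and> T \<subseteq> c} = lam" if "T \<subseteq> {..<n}" "card T = Suc k" for T
      using that by simp
    obtain T where T: "T \<subseteq> {..<n}" "card T = k + 1" "T \<notin> dual" by (rule ex_non_dual[OF h k_le])
    have eq: "card {c\<in>F. card c = h \<and> T \<subseteq> c} = lam" "card {c\<in>F. card c = h \<and> y0 \<subseteq> c} = lam"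
      using T y0 dual_subset[OF y0(1)] by (auto intro: lam)
    have "int (Suc lam) * 2 ^ (k + 1) = int (card F) * 1"
      using count[of T, unfolded eq(1)] T by (simp only: of_bool_def) simp
    moreover have "int (Suc lam) * 2 ^ (k + 1) = int (card F) * 2"
      using count[of y0, unfolded eq(2)] y0 dual_subset[OF y0(1)] by (simp only: of_bool_def) simp
    ultimately show False using card_F_pos by linarith
  qed
qed

text \<open>The weight lies between \<open>k + 1\<close> and \<open>n - (k + 1)\<close> and is even,
  which is the range where \<open>y0\<close> and a non-dual \<open>(k + 1)\<close>-set have
  different counts in \<open>dual_not_design\<close>.\<close>

lemma dual_code_design:
  assumes "y \<in> dual" "0 < card y" "card y < n"
  shows "is_t_design n (card y) {x\<in>dual. card x = card y} k"
    and "\<not> is_t_design n (card y) {x\<in>dual. card x = card y} (Suc k)"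
proof -
  have cV: "card {..<n} = 2 * h" using n_eq by simp
  have ne: "y \<noteq> {}" using assms by auto
  have ky: "k + 1 \<le> card y" using str assms(1) ne by (auto simp: strength_def)
  have yk: "card y \<le> card {..<n} - (k + 1)"
    by (rule dual_weight_le[OF str h odd_k assms(1)]) (use assms ne in auto)
  have "\<exists>lam. \<forall>T. T \<subseteq> {..<n} \<and> card T = k \<longrightarrow> card {x\<in>dual. card x = card y \<and> T \<subseteq> x} = lam"
  proof -
    have "{..<k} \<subseteq> {..<n}" using k_le n_eq by auto
    then have "card {x\<in>dual. card x = card y \<and> T \<subseteq> x} = card {x\<in>dual. card x = card y \<and> {..<k} \<subseteq> x}"
      if "T \<subseteq> {..<n}" "card T = k" for T
      using dual_design[OF str cV h that(1), of "{..<k}" k "card y"] that k_pos ky by simp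
    then show ?thesis by blast
  qed
  then show "is_t_design n (card y) {x\<in>dual. card x = card y} k"
    using dual_subset ky unfolding is_t_design_def by (auto simp: conj_assoc)
  show "\<not> is_t_design n (card y) {x\<in>dual. card x = card y} (Suc k)"
  proof
    assume "is_t_design n (card y) {x\<in>dual. card x = card y} (Suc k)"
    from is_t_design_weightD[OF this] obtain lam where
      "\<forall>T. T \<subseteq> {..<n} \<and> card T = Suc k \<longrightarrow> card {x\<in>dual. card x = card y \<and> T \<subseteq> x} = lam" ..
    then have lam: "card {x\<in>dual. card x = card y \<and> T \<subseteq> x} = lam"
      if "T \<subseteq> {..<n}" "card T = Suc k" for T
      using that by simp
    obtain T where T: "T \<subseteq> {..<n}" "card T = k + 1" "T \<notin> dual" by (rule ex_non_dual[OF h k_le])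
    have "card {x\<in>dual. card x = card y \<and> y0 \<subseteq> x} \<noteq> card {x\<in>dual. card x = card y \<and> T \<subseteq> x}"
      by (rule dual_not_design[OF str cV h y0(1) T(1,3) y0(2) T(2) _ _ Suc_k_le ky yk even_card_dual[OF assms(1)]])
        simp_all
    moreover have "card {x\<in>dual. card x = card y \<and> y0 \<subseteq> x} = lam"
      by (rule lam) (use y0 dual_subset[OF y0(1)] in auto)
    moreover have "card {x\<in>dual. card x = card y \<and> T \<subseteq> x} = lam"
      by (rule lam) (use T in auto)
    ultimately show False by simp
  qed
qed

end

section \<open>The parameters, by the number of inner weights\<close>

theorem theorem1p1:
  fixes n t :: nat and C :: "(nat \<Rightarrow> bit) set"
  assumes code: "binary_linear_code n C"
    and ones: "ones_vec n \<in> C"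
    and dual_nonzero: "dual_code n C \<noteq> {zero_vec}"
    and tpos: "0 < t"
    and hyp: "int (min_weight n (dual_code n C)) - int t
              = int (card {u. weight_class n C u \<noteq> {} \<and> 0 < u \<and> u \<le> n - t})"
  shows
    "(int (min_weight n (dual_code n C)) - int t = 1 \<longrightarrow>
        ((min_weight n (dual_code n C), t) = (2, 1) \<or> (min_weight n (dual_code n C), t) = (4, 3)) \<and>
        delta_code n C = s_code n C \<and>
        s_code n C = delta_code n (dual_code n C) \<and>
        delta_code n (dual_code n C) = s_code n (dual_code n C) \<and>
        (delta_code n C = 1 \<or> delta_code n C = 3))
   \<and> (int (min_weight n (dual_code n C)) - int t = 2 \<longrightarrow>
        (min_weight n (dual_code n C), t) = (4, 2))
   \<and> (int (min_weight n (dual_code n C)) - int t = 3 \<longrightarrow>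
        (min_weight n (dual_code n C), t) \<in> {(4, 1), (6, 3), (8, 5)})"
proof -
  define F where "F = supp n ` C"
  define S where "S = {u. (\<exists>c\<in>F. card c = u) \<and> 0 < u \<and> u \<le> n - t}"
  define d where "d = min_weight n (dual_code n C)"
  interpret set_code "{..<n}" F unfolding F_def by (rule set_code_supp[OF code])
  have "supp n (ones_vec n) = {..<n}" by (auto simp: supp_def ones_vec_def)
  then have "{..<n} \<in> F" using ones unfolding F_def by (metis imageI)
  then interpret ones_code "{..<n}" F by unfold_locales
  have dual: "supp n ` dual_code n C = dual" unfolding F_def by (rule supp_dual_code[OF code])
  have vecs: "dual_code n C \<subseteq> vecs n" by (auto simp: dual_code_def)
  have d: "d = Min (card ` (dual - {{}}))"
    unfolding d_def min_weight_supp[OF vecs] dual ..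
  have "zero_vec \<in> dual_code n C" by (simp add: dual_code_def vecs_def zero_vec_def)
  then obtain y where "y \<in> dual_code n C" "y \<noteq> zero_vec" using dual_nonzero by auto
  then have "supp n y \<in> dual - {{}}" using supp_eq_empty_iff[of y n] vecs dual by auto
  then have fin: "finite (card ` (dual - {{}}))" "card ` (dual - {{}}) \<noteq> {}"
    using finite_dual by auto
  then have "d \<in> card ` (dual - {{}})" unfolding d by (rule Min_in)
  then obtain y0 where y0: "y0 \<in> dual" "y0 \<noteq> {}" "card y0 = d" by auto
  have "finite y0" using dual_subset[OF y0(1)] finite_subset by blast
  then have "0 < d" using y0 by (auto simp: card_gt_0_iff)
  \<comment> \<open>The largest strength that the minimum dual weight \<open>d\<close>
    allows.\<close>
  define k where "k = d - 1"
  have dk: "d = k + 1" using \<open>0 < d\<close> by (simp add: k_def)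
  have str: "strength k"
    unfolding strength_def
  proof (intro ballI impI)
    fix y assume "y \<in> dual" "y \<noteq> {}"
    then have "d \<le> card y" unfolding d using fin by (intro Min_le) auto
    then show "k < card y" by (simp add: dk)
  qed
  have "even d" using even_card_dual y0 by blast
  have "d \<le> n" using dual_subset[OF y0(1)] y0(3) card_mono[of "{..<n}" y0] by simp
  have S: "int d - int t = int (card S)"
    using hyp unfolding S_def d_def F_def weight_class_nonempty_iff .
  then have dS: "d = t + card S" by simp
  have inner_S: "inner = S" if "card S \<noteq> 0"
  proof
    show "inner \<subseteq> S"
    proof
      fix w assume w: "w \<in> inner"
      have "w \<le> card {..<n} - t"
        by (rule inner_le[OF str _ _ _ tpos y0(1) _ w, where S = S])
          (use that dS dk y0 in \<open>auto simp: S_def\<close>)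
      then show "w \<in> S" using w by (simp add: S_def inner_def)
    qed
    show "S \<subseteq> inner" using tpos dS \<open>d \<le> n\<close> by (auto simp: S_def inner_def)
  qed
  have bound: "k \<le> 2 * card inner + 1" by (rule strength_le[OF str]) (use \<open>d \<le> n\<close> dk in simp)
  have one: "((d, t) = (2, 1) \<or> (d, t) = (4, 3)) \<and>
        delta_code n C = s_code n C \<and>
        s_code n C = delta_code n (dual_code n C) \<and>
        delta_code n (dual_code n C) = s_code n (dual_code n C) \<and>
        (delta_code n C = 1 \<or> delta_code n C = 3)" if s: "card S = 1"
  proof -
    obtain h where h: "inner = {h}" using inner_S s by (metis card_1_singletonE zero_neq_one)
    have "k \<le> 3" "t = k" using bound h dS dk s by auto
    then have "k = 1 \<or> k = 2 \<or> k = 3" using tpos by linarith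
    then have kt: "k = 1 \<or> k = 3" using \<open>even d\<close> dk by auto
    have "h \<in> inner" using h by simp
    then have "h \<in> S" using inner_S s by simp
    then have "h \<le> n - t" by (simp add: S_def)
    \<comment> \<open>As \<open>n = 2 * h\<close> and \<open>t = k\<close>, the bound
      \<open>h \<le> n - t\<close> reads \<open>k \<le> h\<close>.\<close>
    then have "k \<le> h" using inner_singleton_half[OF h] \<open>t = k\<close> \<open>d \<le> n\<close> dk by simp
    interpret single_weight_code n F h k y0
      by unfold_locales (use str h \<open>k \<le> h\<close> kt y0 dk in auto)
    have "inner_weights n C = inner"
      unfolding inner_weights_def weight_class_nonempty_iff F_def[symmetric] inner_def by simp
    then have iw: "inner_weights n C = {h}" using h by simp
    have sd: "support_design n C w = {c\<in>F. card c = w}"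
      and sdd: "support_design n (dual_code n C) w = {y\<in>dual. card y = w}" for w
      unfolding support_design_supp dual F_def by (rule refl)+
    have C: "delta_code n C = k" "s_code n C = k"
      by (rule delta_s_code_eqI; use iw code_design in \<open>simp add: sd\<close>)+
    have iwd: "w \<in> inner_weights n (dual_code n C) \<longleftrightarrow> 0 < w \<and> w < n \<and> (\<exists>y\<in>dual. card y = w)" for w
      unfolding inner_weights_def weight_class_nonempty_iff dual by simp
    \<comment> \<open>From \<open>d \<le> h < n\<close>: the minimum dual weight is itself an inner
      weight of the dual.\<close>
    have "d < n" using Suc_k_le n_eq dk by simp
    then have "d \<in> inner_weights n (dual_code n C)"
      unfolding iwd using y0 dk by auto
    then have "inner_weights n (dual_code n C) \<noteq> {}" by auto
    then have D: "delta_code n (dual_code n C) = k" "s_code n (dual_code n C) = k"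
      by (rule delta_s_code_eqI; use iwd dual_code_design in \<open>auto simp: sdd\<close>)+
    show ?thesis using C D kt dk \<open>t = k\<close> by auto
  qed
  have two: "(d, t) = (4, 2)" if s: "card S = 2"
  proof -
    have inner: "inner = S" using inner_S s by simp
    have "k \<le> 5" using bound s inner by simp
    then have "d \<le> 6" "3 \<le> d" using dk dS s tpos by auto
    moreover have "d \<noteq> 6"
    proof
      assume "d = 6"
      obtain u v where uv: "inner = {u, v}" "u < v"
        using s inner by (metis card_2_iff doubleton_eq_iff linorder_neqE_nat)
      have uvn: "u < n" "v < n" "0 < u" using uv by (auto simp: inner_def)
      have "n - u \<in> {u, v}" "n - v \<in> {u, v}" using inner_compl uv by auto
      \<comment> \<open>Complementation reverses the order of weights, so it swaps \<open>u\<close>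
        and \<open>v\<close>.\<close>
      then have sum: "u + v = n" using uv uvn by auto
      have "strength 4" using str dk \<open>d = 6\<close> by (auto simp: strength_def)
      then have "n = 6"
        using card_V_of_two_weights[OF _ uv(1,2)] sum \<open>d \<le> n\<close> \<open>d = 6\<close> by simp
      moreover have "v \<in> inner" using uv by simp
      then have "v \<in> S" using inner by simp
      \<comment> \<open>Here \<open>t = 4\<close>, so \<open>v \<le> 2\<close>, although
        \<open>v\<close> is the larger of two weights with sum 6.\<close>
      then have "v \<le> n - t" by (simp add: S_def)
      ultimately show False using sum uv dS s \<open>d = 6\<close> by simp
    qed
    ultimately have "d = 3 \<or> d = 4 \<or> d = 5" by linarith
    then have "d = 4" using \<open>even d\<close> by auto
    then show ?thesis using dS s by simp
  qed
  have three: "(d, t) \<in> {(4, 1), (6, 3), (8, 5)}" if s: "card S = 3"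
  proof -
    \<comment> \<open>The strength bound gives \<open>d \<le> 8\<close>, positivity of
      \<open>t\<close> gives \<open>d \<ge> 4\<close>, and evenness leaves the three listed
      values.\<close>
    have "k \<le> 7" using bound inner_S s by simp
    then have "d \<le> 8" "4 \<le> d" using dk dS s tpos by auto
    then have "d = 4 \<or> d = 5 \<or> d = 6 \<or> d = 7 \<or> d = 8" by linarith
    then have "d = 4 \<or> d = 6 \<or> d = 8" using \<open>even d\<close> by auto
    then show ?thesis using dS s by auto
  qed
  show ?thesis
    unfolding d_def[symmetric] S
    by (rule conjI[OF impI[OF one] conjI[OF impI[OF two] impI[OF three]]]) simp_all
qed

end
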